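(* Let $X,Y,A,B$ be second countable compact Hausdorff spaces, $H$ a separable Hilbert space, and let $E=(E(\cdot|x))_{x\in X}$ and $F=(F(\cdot|y))_{y\in Y}$ be operator-valued information channels with values in $\mathcal{B}(H)$, from $X$ to $A$ and from $Y$ to $B$, respectively, with commuting ranges. There exists a unique operator-valued information channel $E\cdot F$ from $X\times Y$ to $A\times B$ with values in $\mathcal{B}(H)$ such that $$(E\cdot F)(\delta\times\theta|x,y)=E(\delta|x)F(\theta|y),\qquad \delta\in\mathfrak{A}_A,\ \theta\in\mathfrak{A}_B,\ x\in X,\ y\in Y.$$ Moreover, if $E$ and $F$ are projection-valued information channels, then so is $E\cdot F$.
   Context: $\mathfrak{A}_A$ denotes the Borel $\sigma$-algebra of $A$. A quantum probability measure (QPM) on a compact Hausdorff space $A$ with values in $\mathcal{B}(H)$ is a map $E:\mathfrak{A}_A\to\mathcal{B}(H)^+$ with $E(A)=I_H$ that is countably additive on disjoint sequences of Borel sets in the weak* topology; it is a spectral measure if every $E(\alpha)$ is a projection. An operator-valued information channel from $X$ to $A$ with values in $\mathcal{B}(H)$ is a family $(E(\cdot|x))_{x\in X}$ of QPM's on $A$ with values in $\mathcal{B}(H)$ such that for every $\alpha\in\mathfrak{A}_A$ and all $\xi,\eta\in H$ the function $x\mapsto\langle E(\alpha|x)\xi,\eta\rangle$ is Borel; it is projection-valued if each $E(\cdot|x)$ is a spectral measure. $E$ and $F$ have commuting ranges if $E(\alpha|x)F(\beta|y)=F(\beta|y)E(\alpha|x)$ for all $x,y$ and all Borel $\alpha\subseteq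 A$, $\beta\subseteq B$. *)

theory Defs
  imports "HOL-Analysis.Analysis"
begin

section \<open>Complex Hilbert spaces\<close>

text \<open>
  A complex Hilbert space is presented as a complete real inner product space together with a
  complex scalar multiplication extending the real one and a complex inner product (linear in the
  first argument) whose real part is the given real inner product. Positive definiteness and the
  relation to the norm are then inherited from \<^class>\<open>real_inner\<close>.
\<close>

class complex_hilbert_space = real_inner + complete_space +
  fixes scaleC :: "complex \<Rightarrow> 'a \<Rightarrow> 'a"  (infixr "*\<^sub>C" 75)
    and cinner :: "'a \<Rightarrow> 'a \<Rightarrow> complex"
  assumes scaleC_add_right: "c *\<^sub>C (x + y) = c *\<^sub>C x + c *\<^sub>C y"
    and scaleC_add_left: "(c + d) *\<^sub>C x = c *\<^sub>C x + d *\<^sub>C x"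
    and scaleC_scaleC: "c *\<^sub>C (d *\<^sub>C x) = (c * d) *\<^sub>C x"
    and scaleC_of_real: "complex_of_real r *\<^sub>C x = r *\<^sub>R x"
    and cinner_commute: "cinner x y = cnj (cinner y x)"
    and cinner_add_left: "cinner (x + y) z = cinner x z + cinner y z"
    and cinner_scaleC_left: "cinner (c *\<^sub>C x) y = c * cinner x y"
    and Re_cinner: "Re (cinner x y) = inner x y"

instantiation complex :: complex_hilbert_space
begin
definition "scaleC_complex (c :: complex) (x :: complex) = c * x"
definition "cinner_complex (x :: complex) (y :: complex) = x * cnj y"
instance
  by standard
    (simp_all add: scaleC_complex_def cinner_complex_def algebra_simps scaleR_conv_of_real
      inner_complex_def)
end

section \<open>Operators\<close>

text \<open>
  Elements of the library type of real-linear bounded maps represent operators; the algebra of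
  bounded operators consists of the complex-linear ones.
\<close>

definition bounded_ops :: "('h :: complex_hilbert_space \<Rightarrow>\<^sub>L 'h) set" where
  "bounded_ops = {T. \<forall>c \<xi>. blinfun_apply T (c *\<^sub>C \<xi>) = c *\<^sub>C blinfun_apply T \<xi>}"

definition positive_ops :: "('h :: complex_hilbert_space \<Rightarrow>\<^sub>L 'h) set" where
  "positive_ops = {T \<in> bounded_ops. \<forall>\<xi>. cinner (blinfun_apply T \<xi>) \<xi> \<in> \<real>\<^sub>\<ge>\<^sub>0}"

definition projections :: "('h :: complex_hilbert_space \<Rightarrow>\<^sub>L 'h) set" where
  "projections = {P \<in> bounded_ops. P o\<^sub>L P = P \<and>
     (\<forall>\<xi> \<eta>. cinner (blinfun_apply P \<xi>) \<eta> = cinner \<xi> (blinfun_apply P \<eta>))}"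

text \<open>
  The weak* topology on the bounded operators, as the dual of the trace class operators, is the
  ultraweak topology: it is generated by the functionals
  \<open>T \<mapsto> tr (T S) = (\<Sum>k. cinner (T (\<xi> k)) (\<eta> k))\<close>, where
  \<open>S = (\<Sum>k. cinner _ (\<eta> k) *\<^sub>C \<xi> k)\<close> with square-summable \<open>\<xi>\<close>, \<open>\<eta>\<close> is a general
  trace class operator.
\<close>

definition square_summable :: "(nat \<Rightarrow> 'h :: complex_hilbert_space) \<Rightarrow> bool" where
  "square_summable \<xi> \<longleftrightarrow> summable (\<lambda>k. (norm (\<xi> k))\<^sup>2)"

definition weak_star_topology :: "('h :: complex_hilbert_space \<Rightarrow>\<^sub>L 'h) topology" where
  "weak_star_topology = topology_generated_by
     {{T \<in> bounded_ops. (\<Sum>k. cinner (blinfun_apply T (\<xi> k)) (\<eta> k)) \<in> U} | \<xi> \<eta> U.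
        square_summable \<xi> \<and> square_summable \<eta> \<and> open U}"

section \<open>Quantum probability measures and channels\<close>

definition borel_of :: "'a topology \<Rightarrow> 'a measure" where
  "borel_of A = sigma (topspace A) {U. openin A U}"

text \<open>
  Maps defined on a Borel \<open>\<sigma>\<close>-algebra and families indexed by the points of a space are
  extensional functions (\<open>\<rightarrow>\<^sub>E\<close>), so that equality of such functions is equality of the maps
  they represent.
\<close>

definition qpm :: "'a topology \<Rightarrow> ('a set \<Rightarrow> 'h :: complex_hilbert_space \<Rightarrow>\<^sub>L 'h) \<Rightarrow> bool" where
  "qpm A M \<longleftrightarrow>
     M \<in> sets (borel_of A) \<rightarrow>\<^sub>E positive_ops \<and>
     M (topspace A) = id_blinfun \<and>
     (\<forall>\<alpha> :: nat \<Rightarrow> 'a set. range \<alpha> \<subseteq> sets (borel_of A) \<and> disjoint_family \<alpha> \<longrightarrow>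
        limitin weak_star_topology (\<lambda>n. \<Sum>i<n. M (\<alpha> i)) (M (\<Union>i. \<alpha> i)) sequentially)"

definition spectral_measure ::
    "'a topology \<Rightarrow> ('a set \<Rightarrow> 'h :: complex_hilbert_space \<Rightarrow>\<^sub>L 'h) \<Rightarrow> bool" where
  "spectral_measure A M \<longleftrightarrow> qpm A M \<and> (\<forall>\<alpha> \<in> sets (borel_of A). M \<alpha> \<in> projections)"

text \<open>\<open>E x \<alpha>\<close> stands for \<open>E(\<alpha>|x)\<close>.\<close>

definition info_channel ::
    "'x topology \<Rightarrow> 'a topology \<Rightarrow>
     ('x \<Rightarrow> 'a set \<Rightarrow> 'h :: complex_hilbert_space \<Rightarrow>\<^sub>L 'h) \<Rightarrow> bool" where
  "info_channel X A E \<longleftrightarrow>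
     E \<in> topspace X \<rightarrow>\<^sub>E {M. qpm A M} \<and>
     (\<forall>\<alpha> \<in> sets (borel_of A). \<forall>\<xi> \<eta>.
        (\<lambda>x. cinner (blinfun_apply (E x \<alpha>) \<xi>) \<eta>) \<in> borel_measurable (borel_of X))"

definition projection_valued_channel ::
    "'x topology \<Rightarrow> 'a topology \<Rightarrow>
     ('x \<Rightarrow> 'a set \<Rightarrow> 'h :: complex_hilbert_space \<Rightarrow>\<^sub>L 'h) \<Rightarrow> bool" where
  "projection_valued_channel X A E \<longleftrightarrow>
     info_channel X A E \<and> (\<forall>x \<in> topspace X. spectral_measure A (E x))"

definition commuting_ranges ::
    "'x topology \<Rightarrow> 'a topology \<Rightarrow> 'y topology \<Rightarrow> 'b topology \<Rightarrow>
     ('x \<Rightarrow> 'a set \<Rightarrow> 'h :: complex_hilbert_space \<Rightarrow>\<^sub>L 'h) \<Rightarrow>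
     ('y \<Rightarrow> 'b set \<Rightarrow> 'h \<Rightarrow>\<^sub>L 'h) \<Rightarrow> bool" where
  "commuting_ranges X A Y B E F \<longleftrightarrow>
     (\<forall>x \<in> topspace X. \<forall>y \<in> topspace Y.
        \<forall>\<alpha> \<in> sets (borel_of A). \<forall>\<beta> \<in> sets (borel_of B).
          E x \<alpha> o\<^sub>L F y \<beta> = F y \<beta> o\<^sub>L E x \<alpha>)"

definition is_product_channel ::
    "'x topology \<Rightarrow> 'a topology \<Rightarrow> 'y topology \<Rightarrow> 'b topology \<Rightarrow>
     ('x \<Rightarrow> 'a set \<Rightarrow> 'h :: complex_hilbert_space \<Rightarrow>\<^sub>L 'h) \<Rightarrow>
     ('y \<Rightarrow> 'b set \<Rightarrow> 'h \<Rightarrow>\<^sub>L 'h) \<Rightarrow>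
     ('x \<times> 'y \<Rightarrow> ('a \<times> 'b) set \<Rightarrow> 'h \<Rightarrow>\<^sub>L 'h) \<Rightarrow> bool" where
  "is_product_channel X A Y B E F G \<longleftrightarrow>
     info_channel (prod_topology X Y) (prod_topology A B) G \<and>
     (\<forall>\<delta> \<in> sets (borel_of A). \<forall>\<theta> \<in> sets (borel_of B).
        \<forall>x \<in> topspace X. \<forall>y \<in> topspace Y.
          G (x, y) (\<delta> \<times> \<theta>) = E x \<delta> o\<^sub>L F y \<theta>)"

end

theory Submission
  imports Defs
begin

text \<open>
  For fixed \<open>x\<close>, \<open>y\<close> and a vector \<open>\<xi>\<close>, the function
  \<open>b(\<alpha>, \<beta>) = \<langle>E(\<alpha>|x) F(\<beta>|y) \<xi>, \<xi>\<rangle>\<close> is a nonnegative bimeasure, because a product of commuting positive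
  operators is positive. By regularity and compactness it is countably additive on rectangles, so
  Caratheodory's theorem extends it to a measure \<open>\<mu>\<^sub>\<xi>\<close> on \<open>A \<times> B\<close>. The sets \<open>\<gamma>\<close> for which
  \<open>\<xi> \<mapsto> \<mu>\<^sub>\<xi>(\<gamma>)\<close> is the quadratic form of an operator \<open>0 \<le> G(\<gamma>) \<le> 1\<close> form a Dynkin system, since bounded
  increasing sequences of positive operators converge strongly; it contains the rectangles, hence all
  Borel sets. Uniqueness, measurability in \<open>(x, y)\<close> and the projection property pass from rectangles
  to all Borel sets by the same induction.
\<close>

section \<open>Effects: complex-linear symmetric operators between 0 and 1\<close>

text \<open>A separately countably additive set function on rectangles need not extend to a measure.
  Positivity is what helps here: finite biadditivity already yields sub- and superadditivity on
  rectangles, and the error of approximating the sides of a rectangle is controlled by the two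
  margins, which are ordinary finite measures. The measures \<mu> are chosen for each vector
  separately, so their quadratic dependence on the vector is not known beforehand. Instead of
  verifying a parallelogram law, the Dynkin induction carries an operator along with each set. Weak*
  additivity is exchanged at the outset for norm convergence at each vector, by way of the
  inequality T^2 \<le> T for effects; afterwards only series of vectors occur. Separability of the
  Hilbert space enters through the parameters:
  \<open>inner (F y \<beta> \<xi>) (E x \<alpha> \<eta>)\<close> pairs two varying vectors, each of
  them only weakly measurable. Throughout, the space is treated as a real one on which
  \<open>\<i>\<close> acts as a skew isometry; \<open>cinner\<close> is recovered from
  \<open>inner\<close> by the lemma below.\<close>

lemma Im_cinner: "Im (cinner x y) = inner x (\<i> *\<^sub>C y)"
proof -
  have "cinner x (\<i> *\<^sub>C y) = cnj (\<i> * cinner y x)"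
    by (metis cinner_commute cinner_scaleC_left)
  also have "\<dots> = - \<i> * cinner x y"
    by (metis cinner_commute complex_cnj_i complex_cnj_mult)
  finally have "Re (cinner x (\<i> *\<^sub>C y)) = Im (cinner x y)" by simp
  then show ?thesis by (simp add: Re_cinner)
qed

lemma cinner_eq_inner:
  "cinner x y = complex_of_real (inner x y) + \<i> * complex_of_real (inner x (\<i> *\<^sub>C y))"
  by (simp add: complex_eq_iff Re_cinner Im_cinner)

lemma scaleC_decompose: "c *\<^sub>C x = Re c *\<^sub>R x + Im c *\<^sub>R (\<i> *\<^sub>C x)"
proof -
  have "c *\<^sub>C x = (complex_of_real (Re c) + complex_of_real (Im c) * \<i>) *\<^sub>C x"
    by (metis complex_eq mult.commute)
  then show ?thesis by (simp only: scaleC_add_left scaleC_of_real flip: scaleC_scaleC)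
qed

text \<open>Real linearity is built into the operator type, so compatibility with
  \<open>\<i>\<close> is all that complex linearity adds.\<close>

lemma bounded_ops_iff:
  "T \<in> bounded_ops \<longleftrightarrow> (\<forall>x. blinfun_apply T (\<i> *\<^sub>C x) = \<i> *\<^sub>C blinfun_apply T x)"
proof
  assume *: "\<forall>x. blinfun_apply T (\<i> *\<^sub>C x) = \<i> *\<^sub>C blinfun_apply T x"
  show "T \<in> bounded_ops"
    unfolding bounded_ops_def
  proof (intro CollectI allI)
    fix c x show "blinfun_apply T (c *\<^sub>C x) = c *\<^sub>C blinfun_apply T x"
      using * by (simp add: scaleC_decompose[of c] blinfun.add_right blinfun.scaleR_right)
  qed
qed (simp add: bounded_ops_def)

lemma inner_i_i: "inner (\<i> *\<^sub>C x) (\<i> *\<^sub>C y) = inner x y" for x y :: "'h :: complex_hilbert_space"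
proof -
  have "inner (\<i> *\<^sub>C x) (\<i> *\<^sub>C y) = Im (\<i> * cinner x y)"
    by (simp only: Im_cinner[symmetric] cinner_scaleC_left)
  then show ?thesis by (simp add: Re_cinner)
qed

lemma scaleC_i_i: "\<i> *\<^sub>C (\<i> *\<^sub>C x) = - x"
  using scaleC_of_real[of "-1" x] by (simp add: scaleC_scaleC)

lemma inner_i_left: "inner (\<i> *\<^sub>C x) y = - inner x (\<i> *\<^sub>C y)" for x y :: "'h :: complex_hilbert_space"
  using inner_i_i[of x "\<i> *\<^sub>C y"] by (simp add: scaleC_i_i)

lemma norm_scaleC_i: "norm (\<i> *\<^sub>C x) = norm x" for x :: "'h :: complex_hilbert_space"
  by (simp add: norm_eq_sqrt_inner inner_i_i)

lemma bounded_linear_scaleC_i: "bounded_linear (\<lambda>x :: 'h :: complex_hilbert_space. \<i> *\<^sub>C x)"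
proof (rule bounded_linear_intro[where K = 1])
  fix r :: real and x :: 'h
  have "\<i> *\<^sub>C (complex_of_real r *\<^sub>C x) = complex_of_real r *\<^sub>C (\<i> *\<^sub>C x)"
    unfolding scaleC_scaleC by (simp add: mult.commute)
  then show "\<i> *\<^sub>C (r *\<^sub>R x) = r *\<^sub>R (\<i> *\<^sub>C x)" by (simp add: scaleC_of_real)
qed (simp_all add: scaleC_add_right norm_scaleC_i)

text \<open>The factor 2 comes from estimating real and imaginary part separately; the bound serves
  to dominate a series.\<close>

lemma norm_cinner_le: "cmod (cinner x y) \<le> 2 * (norm x * norm y)"
proof -
  have "cmod (cinner x y) \<le> \<bar>inner x y\<bar> + \<bar>inner x (\<i> *\<^sub>C y)\<bar>"
    using cmod_le[of "cinner x y"] by (simp add: Re_cinner Im_cinner)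
  then show ?thesis
    using Cauchy_Schwarz_ineq2[of x y] Cauchy_Schwarz_ineq2[of x "\<i> *\<^sub>C y"] by (simp add: norm_scaleC_i)
qed

text \<open>For complex-linear maps, symmetry with respect to the real inner product is
  self-adjointness; the proof of \<open>projections_iff\<close> contains this equivalence.\<close>

definition symmetric_op :: "('h :: complex_hilbert_space \<Rightarrow>\<^sub>L 'h) \<Rightarrow> bool" where
  "symmetric_op T \<longleftrightarrow> T \<in> bounded_ops \<and>
     (\<forall>x y. inner (blinfun_apply T x) y = inner x (blinfun_apply T y))"

text \<open>Effects in the sense of quantum measurement theory: 0 \<le> T \<le> 1 in the operator
  order. The upper bound is what turns information on quadratic forms into norm estimates.\<close>

definition effect :: "('h :: complex_hilbert_space \<Rightarrow>\<^sub>L 'h) \<Rightarrow> bool" where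
  "effect T \<longleftrightarrow> symmetric_op T \<and>
     (\<forall>x. 0 \<le> inner (blinfun_apply T x) x \<and> inner (blinfun_apply T x) x \<le> inner x x)"

lemma symmetric_op_add: "symmetric_op S \<Longrightarrow> symmetric_op T \<Longrightarrow> symmetric_op (S + T)"
  by (simp add: symmetric_op_def bounded_ops_def blinfun.add_left scaleC_add_right inner_simps)

lemma symmetric_op_diff: "symmetric_op S \<Longrightarrow> symmetric_op T \<Longrightarrow> symmetric_op (S - T)"
  unfolding symmetric_op_def bounded_ops_iff
  by (simp add: blinfun.diff_left inner_simps bounded_linear.linear[OF bounded_linear_scaleC_i] linear_diff)

lemma symmetric_op_0: "symmetric_op 0"
  unfolding symmetric_op_def bounded_ops_iff
  by (simp add: bounded_linear.linear[OF bounded_linear_scaleC_i] linear_0)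

lemma symmetric_op_id: "symmetric_op id_blinfun"
  by (simp add: symmetric_op_def bounded_ops_iff)

lemma symmetric_op_sum: "(\<And>i. i \<in> I \<Longrightarrow> symmetric_op (T i)) \<Longrightarrow> symmetric_op (sum T I)"
  by (induction I rule: infinite_finite_induct) (auto intro: symmetric_op_add symmetric_op_0)

lemma symmetric_op_compose:
  assumes "symmetric_op S" "symmetric_op T" "S o\<^sub>L T = T o\<^sub>L S"
  shows "symmetric_op (S o\<^sub>L T)"
  unfolding symmetric_op_def
proof (intro conjI allI)
  show "S o\<^sub>L T \<in> bounded_ops" using assms by (simp add: symmetric_op_def bounded_ops_def)
  fix x y
  have "inner (S (T x)) y = inner x (T (S y))" using assms by (simp add: symmetric_op_def)
  also have "T (S y) = S (T y)" by (metis assms(3) blinfun_apply_blinfun_compose)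
  finally show "inner ((S o\<^sub>L T) x) y = inner x ((S o\<^sub>L T) y)" by simp
qed

text \<open>Polarization at one well-chosen vector: if the form of a symmetric R vanishes, its value
  at \<open>x + R x\<close> reduces to 2 |R x|^2.\<close>

lemma symmetric_op_eqI:
  assumes "symmetric_op S" "symmetric_op T" "\<And>x. inner (blinfun_apply S x) x = inner (blinfun_apply T x) x"
  shows "S = T"
proof (rule blinfun_eqI)
  fix x
  define R where "R = S - T"
  have R: "symmetric_op R" unfolding R_def by (intro symmetric_op_diff assms)
  have q: "inner (R z) z = 0" for z using assms(3)[of z] by (simp add: R_def blinfun.diff_left inner_simps)
  have "inner (R (x + R x)) (x + R x) = inner (R x) x + 2 * inner (R x) (R x) + inner (R (R x)) (R x)"
    using R[unfolded symmetric_op_def, THEN conjunct2, rule_format, of "R x" x]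
    by (simp add: blinfun.add_right inner_simps inner_commute)
  then have "R x = 0" by (simp add: q)
  then show "S x = T x" by (simp add: R_def blinfun.diff_left)
qed

text \<open>Membership in the nonnegative reals includes that \<open>cinner (T x) x\<close> has no
  imaginary part, and polarizing this condition gives symmetry. Conversely, symmetry and complex
  linearity make \<open>inner (T x) (\<i> *\<^sub>C x)\<close> equal to its own negative.\<close>

lemma positive_ops_iff:
  "T \<in> positive_ops \<longleftrightarrow> symmetric_op T \<and> (\<forall>x. 0 \<le> inner (blinfun_apply T x) x)"
proof
  assume T: "T \<in> positive_ops"
  then have b: "T \<in> bounded_ops" and p: "\<And>x. cinner (T x) x \<in> \<real>\<^sub>\<ge>\<^sub>0" by (auto simp: positive_ops_def)
  have re: "0 \<le> inner (T x) x" and im: "inner (T x) (\<i> *\<^sub>C x) = 0" for x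
    using p[of x] by (auto simp: complex_nonneg_Reals_iff Re_cinner Im_cinner)
  have "inner (T x) y = inner x (T y)" for x y
  proof -
    \<comment> \<open>The imaginary parts polarize to an identity pairing \<open>T x\<close> with
      \<open>\<i> *\<^sub>C y'\<close> and \<open>T y'\<close> with \<open>\<i> *\<^sub>C x\<close>;
      the rotated vector makes it the symmetry relation for x and y.\<close>
    define y' where "y' = \<i> *\<^sub>C y"
    have y: "y = - (\<i> *\<^sub>C y')" by (simp add: y'_def scaleC_i_i)
    have i: "\<i> *\<^sub>C - z = - (\<i> *\<^sub>C z)" for z :: 'a
      by (simp add: bounded_linear.linear[OF bounded_linear_scaleC_i] linear_neg)
    have "inner (T (x + y')) (\<i> *\<^sub>C (x + y')) = 0" by (rule im)
    then have "inner (T x) (\<i> *\<^sub>C y') + inner (T y') (\<i> *\<^sub>C x) = 0"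
      using im[of x] im[of y'] by (simp add: scaleC_add_right blinfun.add_right inner_simps)
    moreover have "\<i> *\<^sub>C T y' = - T y" using b by (simp add: y'_def bounded_ops_def scaleC_i_i)
    then have "inner (T y') (\<i> *\<^sub>C x) = inner (T y) x"
      using inner_i_left[of "T y'" x] by simp
    ultimately show ?thesis by (simp add: y inner_commute)
  qed
  with b re show "symmetric_op T \<and> (\<forall>x. 0 \<le> inner (T x) x)" by (simp add: symmetric_op_def)
next
  assume T: "symmetric_op T \<and> (\<forall>x. 0 \<le> inner (T x) x)"
  have "inner (T x) (\<i> *\<^sub>C x) = 0" for x
  proof -
    have "inner (T x) (\<i> *\<^sub>C x) = inner x (\<i> *\<^sub>C T x)"
      using T by (simp add: symmetric_op_def bounded_ops_def)
    also have "\<dots> = - inner (\<i> *\<^sub>C x) (T x)" by (simp add: inner_i_left)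
    finally show ?thesis by (simp add: inner_commute)
  qed
  with T show "T \<in> positive_ops"
    by (auto simp: positive_ops_def symmetric_op_def complex_nonneg_Reals_iff Re_cinner Im_cinner)
qed

lemma projections_iff: "P \<in> projections \<longleftrightarrow> symmetric_op P \<and> P o\<^sub>L P = P"
proof -
  have "(\<forall>x y. cinner (P x) y = cinner x (P y)) \<longleftrightarrow> (\<forall>x y. inner (P x) y = inner x (P y))"
    if b: "P \<in> bounded_ops"
  proof
    assume *: "\<forall>x y. cinner (P x) y = cinner x (P y)"
    show "\<forall>x y. inner (P x) y = inner x (P y)" using * by (metis Re_cinner)
  next
    assume *: "\<forall>x y. inner (P x) y = inner x (P y)"
    show "\<forall>x y. cinner (P x) y = cinner x (P y)"
      using * b by (simp add: cinner_eq_inner bounded_ops_def)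
  qed
  then show ?thesis by (auto simp: projections_def symmetric_op_def)
qed

lemma effect_symmetric: "effect T \<Longrightarrow> symmetric_op T"
  by (simp add: effect_def)

lemma effect_inner: "effect T \<Longrightarrow> inner (blinfun_apply T x) y = inner x (blinfun_apply T y)"
  by (simp add: effect_def symmetric_op_def)

lemma effect_nonneg: "effect T \<Longrightarrow> 0 \<le> inner (blinfun_apply T x) x"
  by (simp add: effect_def)

lemma effect_le: "effect T \<Longrightarrow> inner (blinfun_apply T x) x \<le> inner x x"
  by (simp add: effect_def)

text \<open>This is T^2 \<le> T without spectral theory: positivity is used at
  \<open>x - T x\<close> and the bound by 1 at \<open>T x\<close>.\<close>

lemma effect_norm_square_le:
  assumes "effect T" shows "(norm (blinfun_apply T x))\<^sup>2 \<le> inner (blinfun_apply T x) x"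
proof -
  have "0 \<le> inner (T (x - T x)) (x - T x)" by (rule effect_nonneg[OF assms])
  also have "\<dots> = inner (T x) x - 2 * inner (T x) (T x) + inner (T (T x)) (T x)"
    using effect_inner[OF assms, of "T x" x] by (simp add: blinfun.diff_right inner_simps inner_commute)
  also have "inner (T (T x)) (T x) \<le> inner (T x) (T x)" by (rule effect_le[OF assms])
  finally show ?thesis by (simp add: power2_norm_eq_inner)
qed

lemma effect_norm_le:
  assumes "effect T" shows "norm (blinfun_apply T x) \<le> norm x"
proof -
  have "(norm (T x))\<^sup>2 \<le> (norm x)\<^sup>2"
    using effect_norm_square_le[OF assms, of x] effect_le[OF assms, of x]
    by (simp add: power2_norm_eq_inner)
  then show ?thesis by (simp add: power2_le_iff_abs_le)
qed

lemma effect_complement: "effect T \<Longrightarrow> effect (id_blinfun - T)"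
  by (auto simp: effect_def intro!: symmetric_op_diff symmetric_op_id)
     (simp_all add: blinfun.diff_left inner_simps)

text \<open>Keeps the recursion in the next proof within the effects.\<close>

lemma effect_diff_square:
  assumes "effect T" shows "effect (T - (T o\<^sub>L T))"
  unfolding effect_def
proof (intro conjI allI)
  show "symmetric_op (T - (T o\<^sub>L T))"
    by (intro symmetric_op_diff symmetric_op_compose effect_symmetric assms refl)
  fix x
  have eq: "inner ((T - (T o\<^sub>L T)) x) x = inner (T x) x - (norm (T x))\<^sup>2"
    using effect_inner[OF assms] by (simp add: blinfun.diff_left inner_simps power2_norm_eq_inner)
  show "0 \<le> inner ((T - (T o\<^sub>L T)) x) x" using effect_norm_square_le[OF assms] by (simp add: eq)
  show "inner ((T - (T o\<^sub>L T)) x) x \<le> inner x x"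
    using effect_le[OF assms, of x] zero_le_power2[of "norm (T x)"] unfolding eq by linarith
qed

text \<open>The recursion \<open>S\<^bsub>n+1\<^esub> = S\<^bsub>n\<^esub> - S\<^bsub>n\<^esub>\<^sup>2\<close> writes \<open>S\<close> as a strongly convergent
  sum of squares of operators commuting with \<open>T\<close>; this replaces the square root of \<open>S\<close>.\<close>

lemma effect_compose_nonneg:
  assumes S: "effect S" and T: "effect T" and ST: "S o\<^sub>L T = T o\<^sub>L S"
  shows "0 \<le> inner (blinfun_apply S (blinfun_apply T x)) x"
proof -
  define R where "R n = ((\<lambda>U. U - (U o\<^sub>L U)) ^^ n) S" for n
  have R0: "R 0 = S" and RS: "R (Suc n) = R n - (R n o\<^sub>L R n)" for n by (simp_all add: R_def)
  have eff: "effect (R n)" for n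
    by (induction n) (simp_all add: R0 RS S effect_diff_square)
  have comm: "R n (T z) = T (R n z)" for n z
  proof (induction n arbitrary: z)
    case 0 show ?case by (metis R0 ST blinfun_apply_blinfun_compose)
  qed (simp add: RS blinfun.diff_left blinfun.diff_right)
  \<comment> \<open>The recursion telescopes, so the squares |R k x|^2 are summable and
    \<open>R k x\<close> tends to 0.\<close>
  have "(\<Sum>k<n. (norm (R k x))\<^sup>2) = inner (S x) x - inner (R n x) x" for n
    using effect_inner[OF eff]
    by (induction n) (simp_all add: R0 RS blinfun.diff_left inner_simps power2_norm_eq_inner)
  then have "(\<Sum>k<n. (norm (R k x))\<^sup>2) \<le> inner (S x) x" for n
    using effect_nonneg[OF eff, of n x] by simp
  then have "summable (\<lambda>k. (norm (R k x))\<^sup>2)"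
    by (intro bounded_imp_summable[where B = "inner (S x) x"])
       (simp_all only: zero_le_power2 flip: lessThan_Suc_atMost)
  then have "(\<lambda>k. sqrt ((norm (R k x))\<^sup>2)) \<longlonglongrightarrow> sqrt 0"
    by (rule tendsto_real_sqrt[OF summable_LIMSEQ_zero])
  then have "(\<lambda>k. R k x) \<longlonglongrightarrow> 0" by (simp add: tendsto_norm_zero_iff)
  then have lim: "(\<lambda>k. inner (T x) (R k x)) \<longlonglongrightarrow> inner (T x) 0" by (intro tendsto_intros)
  \<comment> \<open>One step of the recursion lowers \<open>inner (R n (T x)) x\<close> by
    \<open>inner (T (R n x)) (R n x)\<close>, which is nonnegative. The values therefore stay below
    the initial one, and their limit is 0.\<close>
  have "inner (T x) (R n x) \<le> inner (S (T x)) x" for n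
  proof -
    have "inner (R n (T x)) x \<le> inner (S (T x)) x"
    proof (induction n)
      case (Suc n)
      have "inner (R n (R n (T x))) x = inner (T (R n x)) (R n x)"
        using effect_inner[OF eff, of n "R n (T x)" x] by (simp add: comm)
      then show ?case using Suc effect_nonneg[OF T, of "R n x"]
        by (simp add: RS blinfun.diff_left inner_simps)
    qed (simp add: R0)
    then show ?thesis by (simp add: effect_inner[OF eff])
  qed
  then have "inner (T x) 0 \<le> inner (S (T x)) x"
    by (intro LIMSEQ_le_const2[OF lim]) simp
  then show ?thesis by simp
qed

lemma effect_compose:
  assumes S: "effect S" and T: "effect T" and ST: "S o\<^sub>L T = T o\<^sub>L S"
  shows "effect (S o\<^sub>L T)"
  unfolding effect_def
proof (intro conjI allI)
  show "symmetric_op (S o\<^sub>L T)" by (intro symmetric_op_compose effect_symmetric assms)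
  fix x
  show "0 \<le> inner ((S o\<^sub>L T) x) x" using effect_compose_nonneg[OF assms] by simp
  have "inner (S (T x)) x \<le> norm (S (T x)) * norm x" by (rule norm_cauchy_schwarz)
  also have "\<dots> \<le> norm x * norm x"
    using effect_norm_le[OF S, of "T x"] effect_norm_le[OF T, of x] by (intro mult_right_mono) auto
  finally show "inner ((S o\<^sub>L T) x) x \<le> inner x x" by (simp add: dot_square_norm power2_eq_square)
qed

text \<open>The remainders are again effects, so the square of their norm at x is at most their
  quadratic form at x, which tends to 0. Convergence of forms thus becomes strong
  convergence.\<close>

lemma effect_series_sums:
  assumes S: "\<And>i. effect (S i)" and T: "effect T"
    and sums: "\<And>x. (\<lambda>i. inner (blinfun_apply (S i) x) x) sums inner (blinfun_apply T x) x"
  shows "(\<lambda>i. blinfun_apply (S i) x) sums blinfun_apply T x"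
proof -
  define R where "R n = T - (\<Sum>i<n. S i)" for n
  have q: "inner (R n x) x = inner (T x) x - (\<Sum>i<n. inner (S i x) x)" for n x
    by (simp add: R_def blinfun.diff_left blinfun.sum_left inner_simps inner_sum_left)
  have "effect (R n)" for n
    unfolding effect_def
  proof (intro conjI allI)
    show "symmetric_op (R n)" unfolding R_def
      by (intro symmetric_op_diff symmetric_op_sum effect_symmetric S T)
    fix x
    have "(\<Sum>i<n. inner (S i x) x) \<le> inner (T x) x"
      using sum_le_suminf[OF sums_summable[OF sums]] effect_nonneg[OF S] sums_unique[OF sums[of x]] by auto
    then show "0 \<le> inner (R n x) x" by (simp add: q)
    have "0 \<le> (\<Sum>i<n. inner (S i x) x)" by (intro sum_nonneg effect_nonneg S)
    then show "inner (R n x) x \<le> inner x x" using effect_le[OF T, of x] unfolding q by linarith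
  qed
  then have le: "norm (R n x) \<le> sqrt (inner (R n x) x)" for n
    by (intro real_le_rsqrt effect_norm_square_le)
  have "(\<lambda>n. inner (R n x) x) \<longlonglongrightarrow> inner (T x) x - inner (T x) x"
    unfolding q using sums[of x] by (intro tendsto_intros) (simp add: sums_def)
  then have "(\<lambda>n. sqrt (inner (R n x) x)) \<longlonglongrightarrow> sqrt 0" by (intro tendsto_real_sqrt) simp
  then have "(\<lambda>n. sqrt (inner (R n x) x)) \<longlonglongrightarrow> 0" by simp
  then have "(\<lambda>n. norm (R n x)) \<longlonglongrightarrow> 0"
    by (rule tendsto_sandwich[OF _ _ tendsto_const, rotated 2]) (simp_all add: le)
  then have "(\<lambda>n. R n x) \<longlonglongrightarrow> 0" by (rule tendsto_norm_zero_cancel)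
  then have "(\<lambda>n. T x - R n x) \<longlonglongrightarrow> T x - 0" by (intro tendsto_intros)
  then show ?thesis by (simp add: sums_def R_def blinfun.diff_left blinfun.sum_left)
qed

text \<open>Monotone convergence for operators: differences of partial sums are effects, so the
  Cauchy property of the scalar sequence \<open>inner (P n x) x\<close> passes to the vectors
  \<open>P n x\<close>, and completeness supplies the limit.\<close>

lemma effect_series_summable:
  fixes S :: "nat \<Rightarrow> 'h :: complex_hilbert_space \<Rightarrow>\<^sub>L 'h"
  assumes S: "\<And>i. effect (S i)"
    and le: "\<And>n x. (\<Sum>i<n. inner (blinfun_apply (S i) x) x) \<le> inner x x"
  obtains T where "effect T" "\<And>x. (\<lambda>i. blinfun_apply (S i) x) sums blinfun_apply T x"
proof -
  define P where "P n = (\<Sum>i<n. S i)" for n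
  have q: "inner (P n x) x = (\<Sum>i<n. inner (S i x) x)" for n x
    by (simp add: P_def blinfun.sum_left inner_sum_left)
  have symP: "symmetric_op (P n)" for n
    unfolding P_def by (intro symmetric_op_sum effect_symmetric S)
  have effP: "effect (P n)" for n
    unfolding effect_def using symP le effect_nonneg[OF S] by (auto simp: q intro: sum_nonneg)
  have diff: "effect (P n - P m)" if "m \<le> n" for m n
    unfolding effect_def
  proof (intro conjI allI)
    show "symmetric_op (P n - P m)" by (intro symmetric_op_diff symP)
    fix x
    have "inner (P m x) x \<le> inner (P n x) x"
      unfolding q using that effect_nonneg[OF S] by (intro sum_mono2) auto
    then show "0 \<le> inner ((P n - P m) x) x" by (simp add: blinfun.diff_left inner_simps)
    show "inner ((P n - P m) x) x \<le> inner x x"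
      using effect_le[OF effP, of n x] effect_nonneg[OF effP, of m x]
      by (simp add: blinfun.diff_left inner_simps)
  qed
  have "summable (\<lambda>i. inner (S i x) x)" for x
    by (intro bounded_imp_summable[where B = "inner x x"])
       (simp_all only: effect_nonneg[OF S] le flip: lessThan_Suc_atMost)
  then have conv: "convergent (\<lambda>n. inner (P n x) x)" for x
    by (simp add: q summable_iff_convergent)
  have "Cauchy (\<lambda>n. P n x)" for x
  proof (rule CauchyI')
    fix e :: real assume e: "0 < e"
    obtain M where M: "\<And>m n. M \<le> m \<Longrightarrow> M \<le> n \<Longrightarrow> \<bar>inner (P m x) x - inner (P n x) x\<bar> < e\<^sup>2"
      using CauchyD[OF convergent_Cauchy[OF conv[of x]], of "e\<^sup>2"] e by auto
    have "norm (P m x - P n x) < e" if "M \<le> m" "m < n" for m n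
    proof -
      have "(norm (P n x - P m x))\<^sup>2 \<le> inner (P n x) x - inner (P m x) x"
        using effect_norm_square_le[OF diff[of m n], of x] that by (simp add: blinfun.diff_left inner_simps)
      also have "\<dots> < e\<^sup>2" using M[of n m] that by auto
      finally show ?thesis using e by (simp add: norm_minus_commute power_less_imp_less_base)
    qed
    then show "\<exists>M. \<forall>m\<ge>M. \<forall>n>m. dist (P m x) (P n x) < e" unfolding dist_norm by blast
  qed
  then have "convergent (\<lambda>n. P n x)" for x by (rule Cauchy_convergent)
  moreover define t where "t x = lim (\<lambda>n. P n x)" for x
  ultimately have t: "(\<lambda>n. P n x) \<longlonglongrightarrow> t x" for x
    by (simp add: convergent_LIMSEQ_iff)
  have bl: "bounded_linear t"
  proof (rule bounded_linear_intro[where K = 1])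
    fix x y
    have "(\<lambda>n. P n (x + y)) \<longlonglongrightarrow> t x + t y"
      unfolding blinfun.add_right by (intro tendsto_intros t)
    then show "t (x + y) = t x + t y" by (rule LIMSEQ_unique[OF t])
  next
    fix r x
    have "(\<lambda>n. P n (r *\<^sub>R x)) \<longlonglongrightarrow> r *\<^sub>R t x"
      unfolding blinfun.scaleR_right by (intro tendsto_intros t)
    then show "t (r *\<^sub>R x) = r *\<^sub>R t x" by (rule LIMSEQ_unique[OF t])
  next
    fix x
    show "norm (t x) \<le> norm x * 1"
      using LIMSEQ_le_const2[OF tendsto_norm[OF t]] effect_norm_le[OF effP] by auto
  qed
  define T where "T = Blinfun t"
  have T: "(\<lambda>n. P n x) \<longlonglongrightarrow> T x" for x
    using t[of x] by (simp add: T_def bounded_linear_Blinfun_apply[OF bl])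
  show ?thesis
  proof
    show "(\<lambda>i. S i x) sums T x" for x
      using T[of x] by (simp add: sums_def P_def blinfun.sum_left)
    show "effect T"
      unfolding effect_def symmetric_op_def bounded_ops_iff
    proof (intro conjI allI)
      fix x
      have "(\<lambda>n. P n (\<i> *\<^sub>C x)) \<longlonglongrightarrow> \<i> *\<^sub>C T x"
        using bounded_linear.tendsto[OF bounded_linear_scaleC_i T[of x]] symP
        by (simp add: symmetric_op_def bounded_ops_iff)
      then show "T (\<i> *\<^sub>C x) = \<i> *\<^sub>C T x" by (rule LIMSEQ_unique[OF T])
    next
      fix x y
      have "(\<lambda>n. inner (P n x) y) \<longlonglongrightarrow> inner (T x) y" by (intro tendsto_intros T)
      moreover have "(\<lambda>n. inner (P n x) y) \<longlonglongrightarrow> inner x (T y)"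
        unfolding effect_inner[OF effP] by (intro tendsto_intros T)
      ultimately show "inner (T x) y = inner x (T y)" by (rule LIMSEQ_unique)
    next
      fix x
      have lim: "(\<lambda>n. inner (P n x) x) \<longlonglongrightarrow> inner (T x) x" by (intro tendsto_intros T)
      show "0 \<le> inner (T x) x" using LIMSEQ_le_const[OF lim] effect_nonneg[OF effP] by auto
      show "inner (T x) x \<le> inner x x" using LIMSEQ_le_const2[OF lim] effect_le[OF effP] by auto
    qed
  qed
qed

section \<open>Quantum probability measures as strongly additive effect-valued measures\<close>

text \<open>It suffices to test convergence on the subbasis, because the open sets that pass the
  test are closed under finite intersections and arbitrary unions. Membership in the union of the
  subbasis says that the limit lies in the space.\<close>

lemma limitin_topology_generated_by:
  "limitin (topology_generated_by \<S>) f l F \<longleftrightarrow>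
     l \<in> \<Union>\<S> \<and> (\<forall>V\<in>\<S>. l \<in> V \<longrightarrow> (\<forall>\<^sub>F n in F. f n \<in> V))"
proof
  assume "limitin (topology_generated_by \<S>) f l F"
  then show "l \<in> \<Union>\<S> \<and> (\<forall>V\<in>\<S>. l \<in> V \<longrightarrow> (\<forall>\<^sub>F n in F. f n \<in> V))"
    by (auto simp: limitin_def topology_generated_by_topspace topology_generated_by_Basis)
next
  assume *: "l \<in> \<Union>\<S> \<and> (\<forall>V\<in>\<S>. l \<in> V \<longrightarrow> (\<forall>\<^sub>F n in F. f n \<in> V))"
  have "l \<in> U \<longrightarrow> (\<forall>\<^sub>F n in F. f n \<in> U)" if "generate_topology_on \<S> U" for U
    using that
  proof induction
    case (Int a b) then show ?case by (auto simp: eventually_conj_iff)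
  next
    case (UN K)
    show ?case
    proof
      assume "l \<in> \<Union>K"
      then obtain k where k: "k \<in> K" "l \<in> k" by blast
      with UN.IH have "\<forall>\<^sub>F n in F. f n \<in> k" by blast
      then show "\<forall>\<^sub>F n in F. f n \<in> \<Union>K" by eventually_elim (use k in blast)
    qed
  qed (use * in auto)
  with * show "limitin (topology_generated_by \<S>) f l F"
    by (auto simp: limitin_def topology_generated_by_topspace openin_topology_generated_by_iff)
qed

lemma square_summable_0: "square_summable (\<lambda>_. 0)"
  by (simp add: square_summable_def)

lemma limitin_weak_star_iff:
  assumes f: "\<And>n. f n \<in> bounded_ops"
  shows "limitin weak_star_topology f l sequentially \<longleftrightarrow> l \<in> bounded_ops \<and>
    (\<forall>\<xi> \<eta>. square_summable \<xi> \<and> square_summable \<eta> \<longrightarrow>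
      (\<lambda>n. \<Sum>k. cinner (blinfun_apply (f n) (\<xi> k)) (\<eta> k)) \<longlonglongrightarrow> (\<Sum>k. cinner (blinfun_apply l (\<xi> k)) (\<eta> k)))"
    (is "?L \<longleftrightarrow> ?b \<and> ?R")
proof -
  let ?S = "{{T \<in> bounded_ops. (\<Sum>k. cinner (blinfun_apply T (\<xi> k)) (\<eta> k)) \<in> U} | \<xi> \<eta> U.
        square_summable (\<xi> :: nat \<Rightarrow> 'a) \<and> square_summable \<eta> \<and> open U}"
  have S: "\<Union>?S = bounded_ops"
  proof
    \<comment> \<open>Zero sequences and \<open>U = UNIV\<close> exhibit the whole algebra as a
      subbasic set, so it is the underlying space of the topology.\<close>
    have "bounded_ops = {T \<in> bounded_ops. (\<Sum>k. cinner (blinfun_apply T ((\<lambda>_. 0) k)) ((\<lambda>_. 0 :: 'a) k)) \<in> UNIV}"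
      by simp
    then have "bounded_ops \<in> ?S" using square_summable_0 open_UNIV by blast
    then show "bounded_ops \<subseteq> \<Union>?S" by (rule Union_upper)
  qed blast
  have "?L \<longleftrightarrow> ?b \<and> (\<forall>V\<in>?S. l \<in> V \<longrightarrow> (\<forall>\<^sub>F n in sequentially. f n \<in> V))"
    unfolding weak_star_topology_def limitin_topology_generated_by S ..
  also have "\<dots> \<longleftrightarrow> ?b \<and> ?R"
  proof (rule conj_cong[OF refl], safe)
    fix \<xi> \<eta> :: "nat \<Rightarrow> 'a"
    assume b: ?b and *: "\<forall>V\<in>?S. l \<in> V \<longrightarrow> (\<forall>\<^sub>F n in sequentially. f n \<in> V)"
      and ss: "square_summable \<xi>" "square_summable \<eta>"
    show "(\<lambda>n. \<Sum>k. cinner (blinfun_apply (f n) (\<xi> k)) (\<eta> k)) \<longlonglongrightarrow> (\<Sum>k. cinner (blinfun_apply l (\<xi> k)) (\<eta> k))"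
    proof (rule topological_tendstoI)
      fix U :: "complex set"
      assume U: "open U" "(\<Sum>k. cinner (blinfun_apply l (\<xi> k)) (\<eta> k)) \<in> U"
      let ?V = "{T \<in> bounded_ops. (\<Sum>k. cinner (blinfun_apply T (\<xi> k)) (\<eta> k)) \<in> U}"
      have "?V \<in> ?S" using ss U(1) by blast
      moreover have "l \<in> ?V" using b U by blast
      ultimately have "\<forall>\<^sub>F n in sequentially. f n \<in> ?V" using * by blast
      then show "\<forall>\<^sub>F n in sequentially. (\<Sum>k. cinner (blinfun_apply (f n) (\<xi> k)) (\<eta> k)) \<in> U"
        by eventually_elim blast
    qed
  next
    fix \<xi> \<eta> :: "nat \<Rightarrow> 'a" and U :: "complex set"
    assume R: ?R and ss: "square_summable \<xi>" "square_summable \<eta>" and "open U"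
      and "(\<Sum>k. cinner (blinfun_apply l (\<xi> k)) (\<eta> k)) \<in> U"
    then have "\<forall>\<^sub>F n in sequentially. (\<Sum>k. cinner (blinfun_apply (f n) (\<xi> k)) (\<eta> k)) \<in> U"
      using topological_tendstoD by blast
    then show "\<forall>\<^sub>F n in sequentially. f n \<in> {T \<in> bounded_ops. (\<Sum>k. cinner (blinfun_apply T (\<xi> k)) (\<eta> k)) \<in> U}"
      by eventually_elim (simp add: f)
  qed
  finally show ?thesis .
qed

lemma limitin_weak_star_imp_inner:
  assumes f: "\<And>n. f n \<in> bounded_ops" and lim: "limitin weak_star_topology f l sequentially"
  shows "(\<lambda>n. inner (blinfun_apply (f n) x) y) \<longlonglongrightarrow> inner (blinfun_apply l x) y"
proof -
  \<comment> \<open>Sequences supported at index 0 turn the trace functional into a single matrix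
    coefficient.\<close>
  define \<xi> where "\<xi> k = (if k = 0 then x else 0)" for k :: nat
  define \<eta> where "\<eta> k = (if k = 0 then y else 0)" for k :: nat
  have ss: "square_summable \<xi>" "square_summable \<eta>"
    unfolding square_summable_def \<xi>_def \<eta>_def
    by (rule summable_finite[of "{0}"]; simp)+
  have "cinner (T 0) (0 :: 'a) = 0" for T :: "'a \<Rightarrow>\<^sub>L 'a"
    by (simp add: cinner_eq_inner)
  then have "(\<Sum>k. cinner (T (\<xi> k)) (\<eta> k)) = (\<Sum>k\<in>{0}. cinner (T (\<xi> k)) (\<eta> k))"
    for T :: "'a \<Rightarrow>\<^sub>L 'a"
    by (intro suminf_finite) (auto simp: \<xi>_def \<eta>_def)
  then have *: "(\<Sum>k. cinner (T (\<xi> k)) (\<eta> k)) = cinner (T x) y" for T :: "'a \<Rightarrow>\<^sub>L 'a"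
    by (simp add: \<xi>_def \<eta>_def)
  have "(\<lambda>n. \<Sum>k. cinner (f n (\<xi> k)) (\<eta> k)) \<longlonglongrightarrow> (\<Sum>k. cinner (l (\<xi> k)) (\<eta> k))"
    using lim ss limitin_weak_star_iff[where f = f, OF f] by blast
  then have "(\<lambda>n. Re (cinner (f n x) y)) \<longlonglongrightarrow> Re (cinner (l x) y)"
    unfolding * by (rule tendsto_Re)
  then show ?thesis by (simp add: Re_cinner)
qed

text \<open>For contractions the series of matrix coefficients are dominated, uniformly in n, by
  |\<xi> k|^2 + |\<eta> k|^2; Tannery's theorem then exchanges limit and sum.\<close>

lemma limitin_weak_star_of_strong:
  assumes f: "\<And>n. f n \<in> bounded_ops" and l: "l \<in> bounded_ops"
    and le: "\<And>n x. norm (blinfun_apply (f n) x) \<le> norm x"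
    and lim: "\<And>x. (\<lambda>n. blinfun_apply (f n) x) \<longlonglongrightarrow> blinfun_apply l x"
  shows "limitin weak_star_topology f l sequentially"
  unfolding limitin_weak_star_iff[where f = f, OF f]
proof (intro conjI allI impI l)
  fix \<xi> \<eta> :: "nat \<Rightarrow> 'a"
  assume ss: "square_summable \<xi> \<and> square_summable \<eta>"
  have bound: "cmod (cinner (f n (\<xi> k)) (\<eta> k)) \<le> (norm (\<xi> k))\<^sup>2 + (norm (\<eta> k))\<^sup>2" for n k
  proof -
    have "cmod (cinner (f n (\<xi> k)) (\<eta> k)) \<le> 2 * (norm (f n (\<xi> k)) * norm (\<eta> k))" by (rule norm_cinner_le)
    also have "\<dots> \<le> 2 * (norm (\<xi> k) * norm (\<eta> k))" using le by (simp add: mult_right_mono)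
    also have "\<dots> \<le> (norm (\<xi> k))\<^sup>2 + (norm (\<eta> k))\<^sup>2"
      using sum_squares_bound[of "norm (\<xi> k)" "norm (\<eta> k)"] by simp
    finally show ?thesis .
  qed
  show "(\<lambda>n. \<Sum>k. cinner (f n (\<xi> k)) (\<eta> k)) \<longlonglongrightarrow> (\<Sum>k. cinner (l (\<xi> k)) (\<eta> k))"
  proof (rule tannerys_theorem[THEN conjunct2, THEN conjunct2])
    show "\<forall>\<^sub>F (k, n) in at_top \<times>\<^sub>F sequentially. norm (cinner (f n (\<xi> k)) (\<eta> k)) \<le> (norm (\<xi> k))\<^sup>2 + (norm (\<eta> k))\<^sup>2"
      using bound by (intro always_eventually) auto
    show "summable (\<lambda>k. (norm (\<xi> k))\<^sup>2 + (norm (\<eta> k))\<^sup>2)"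
      using ss by (simp add: square_summable_def summable_add)
    show "(\<lambda>n. cinner (f n (\<xi> k)) (\<eta> k)) \<longlonglongrightarrow> cinner (l (\<xi> k)) (\<eta> k)" for k
      unfolding cinner_eq_inner by (intro tendsto_intros lim)
  qed simp
qed

section \<open>Borel sets of a topology and measures with values in the effects\<close>

lemma space_borel_of [simp]: "space (borel_of A) = topspace A"
  by (simp add: borel_of_def space_measure_of_conv)

lemma sets_borel_of: "sets (borel_of A) = sigma_sets (topspace A) {U. openin A U}"
  unfolding borel_of_def by (rule sets_measure_of) (auto dest: openin_subset)

lemma topspace_in_borel_of [simp]: "topspace A \<in> sets (borel_of A)"
  by (metis space_borel_of sets.top)

lemma sets_borel_of_subset: "\<alpha> \<in> sets (borel_of A) \<Longrightarrow> \<alpha> \<subseteq> topspace A"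
  using sets.sets_into_space by fastforce

lemma openin_in_borel_of: "openin A U \<Longrightarrow> U \<in> sets (borel_of A)"
  by (simp add: sets_borel_of sigma_sets.Basic)

lemma closedin_in_borel_of: "closedin A C \<Longrightarrow> C \<in> sets (borel_of A)"
  by (metis closedin_def openin_in_borel_of space_borel_of sets.compl_sets double_diff order_refl)

text \<open>Stated over an arbitrary \<sigma>-algebra, and without extensionality, so that it also
  applies to the product \<open>\<Otimes>\<^sub>M\<close>. Additivity is strong, in contrast to the
  weak* additivity of \<open>qpm\<close>.\<close>

definition effect_measure :: "'a measure \<Rightarrow> ('a set \<Rightarrow> 'h :: complex_hilbert_space \<Rightarrow>\<^sub>L 'h) \<Rightarrow> bool" where
  "effect_measure N M \<longleftrightarrow> (\<forall>\<alpha>\<in>sets N. effect (M \<alpha>)) \<and> M (space N) = id_blinfun \<and>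
     (\<forall>\<alpha> :: nat \<Rightarrow> 'a set. range \<alpha> \<subseteq> sets N \<and> disjoint_family \<alpha> \<longrightarrow>
        (\<forall>x. (\<lambda>i. blinfun_apply (M (\<alpha> i)) x) sums blinfun_apply (M (\<Union>i. \<alpha> i)) x))"


text \<open>From left to right, weak* additivity gives additivity of the quadratic forms, which
  \<open>effect_series_sums\<close> makes strong. From right to left, the partial sums are effects,
  hence contractions, so strong convergence implies weak* convergence.\<close>

lemma qpm_iff_effect_measure:
  "qpm A M \<longleftrightarrow> M \<in> extensional (sets (borel_of A)) \<and> effect_measure (borel_of A) M"
proof
  assume q: "qpm A M"
  let ?S = "sets (borel_of A)"
  have pos: "M \<alpha> \<in> positive_ops" if "\<alpha> \<in> ?S" for \<alpha>
    using q that by (auto simp: qpm_def)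
  then have bd: "(\<Sum>i<n. M (\<alpha> i)) \<in> bounded_ops" if "range \<alpha> \<subseteq> ?S" for n :: nat and \<alpha>
    using that symmetric_op_sum[of "{..<n}" "\<lambda>i. M (\<alpha> i)"] by (auto simp: positive_ops_iff symmetric_op_def)
  have lim: "(\<lambda>i. inner (M (\<alpha> i) x) y) sums inner (M (\<Union>i. \<alpha> i) x) y"
    if "range \<alpha> \<subseteq> ?S" "disjoint_family \<alpha>" for \<alpha> x y
    using limitin_weak_star_imp_inner[where l = "M (\<Union>i. \<alpha> i)" and x = x and y = y, OF bd[OF that(1)]] q that
    by (simp add: qpm_def sums_def blinfun.sum_left inner_sum_left)
  \<comment> \<open>The constant sequence of empty sets is disjoint, and a convergent series with
    constant terms has zero terms.\<close>
  have empty: "M {} = 0"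
  proof (rule blinfun_eqI)
    fix x
    have "(\<lambda>i :: nat. inner (M {} x) (M {} x)) sums inner (M {} x) (M {} x)"
      using lim[of "\<lambda>_. {}" x "M {} x"] by (simp add: disjoint_family_on_def)
    then have "(\<lambda>i :: nat. inner (M {} x) (M {} x)) \<longlonglongrightarrow> 0"
      by (intro summable_LIMSEQ_zero) (rule sums_summable)
    then show "M {} x = blinfun_apply 0 x" by (simp add: LIMSEQ_const_iff)
  qed
  have add: "inner (M \<alpha> x) x + inner (M \<beta> x) x = inner (M (\<alpha> \<union> \<beta>) x) x"
    if "\<alpha> \<in> ?S" "\<beta> \<in> ?S" "\<alpha> \<inter> \<beta> = {}" for \<alpha> \<beta> x
  proof -
    have "(\<lambda>i. inner (M (binaryset \<alpha> \<beta> i) x) x) sums inner (M (\<Union>i. binaryset \<alpha> \<beta> i) x) x"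
      using that by (intro lim) (auto simp: range_binaryset_eq disjoint_family_on_def binaryset_def)
    moreover have "(\<lambda>i. inner (M (binaryset \<alpha> \<beta> i) x) x) sums (inner (M \<alpha> x) x + inner (M \<beta> x) x)"
      by (rule binaryset_sums) (simp add: empty)
    ultimately show ?thesis using sums_unique2 by (fastforce simp: UN_binaryset_eq)
  qed
  have eff: "effect (M \<alpha>)" if \<alpha>: "\<alpha> \<in> ?S" for \<alpha>
    unfolding effect_def
  proof (intro conjI allI)
    show "symmetric_op (M \<alpha>)" using pos[OF \<alpha>] by (simp add: positive_ops_iff)
    fix x
    show "0 \<le> inner (M \<alpha> x) x" using pos[OF \<alpha>] by (simp add: positive_ops_iff)
    \<comment> \<open>The values are so far only known to be positive; the bound by 1 comes from
      positivity at the complement.\<close>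
    have "topspace A - \<alpha> \<in> ?S" using \<alpha> by (metis sets.compl_sets space_borel_of)
    moreover have "\<alpha> \<union> (topspace A - \<alpha>) = topspace A" using sets_borel_of_subset[OF \<alpha>] by blast
    ultimately have "inner (M \<alpha> x) x + inner (M (topspace A - \<alpha>) x) x = inner x x"
      using add[OF \<alpha>, of "topspace A - \<alpha>" x] q by (simp add: qpm_def)
    moreover have "0 \<le> inner (M (topspace A - \<alpha>) x) x"
      using pos \<open>topspace A - \<alpha> \<in> ?S\<close> by (simp add: positive_ops_iff)
    ultimately show "inner (M \<alpha> x) x \<le> inner x x" by linarith
  qed
  have "(\<lambda>i. M (\<alpha> i) x) sums M (\<Union>i. \<alpha> i) x"
    if \<alpha>: "range \<alpha> \<subseteq> ?S" "disjoint_family \<alpha>" for \<alpha> x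
    using \<alpha> by (intro effect_series_sums eff lim) auto
  with q eff show "M \<in> extensional ?S \<and> effect_measure (borel_of A) M"
    by (auto simp: qpm_def effect_measure_def PiE_def)
next
  assume *: "M \<in> extensional (sets (borel_of A)) \<and> effect_measure (borel_of A) M"
  then have eff: "effect (M \<alpha>)" if "\<alpha> \<in> sets (borel_of A)" for \<alpha>
    using that by (auto simp: effect_measure_def)
  show "qpm A M"
    unfolding qpm_def
  proof (intro conjI allI impI)
    show "M \<in> sets (borel_of A) \<rightarrow>\<^sub>E positive_ops"
      using * eff by (auto simp: PiE_def positive_ops_iff effect_def)
    show "M (topspace A) = id_blinfun" using * by (simp add: effect_measure_def)
    fix \<alpha> :: "nat \<Rightarrow> 'a set"
    assume \<alpha>: "range \<alpha> \<subseteq> sets (borel_of A) \<and> disjoint_family \<alpha>"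
    then have sums: "(\<lambda>i. M (\<alpha> i) x) sums M (\<Union>i. \<alpha> i) x" for x
      using * by (auto simp: effect_measure_def)
    have Un: "effect (M (\<Union>i. \<alpha> i))" using \<alpha> by (intro eff) auto
    have eff_i: "effect (M (\<alpha> i))" for i using \<alpha> by (intro eff) auto
    have sym: "symmetric_op (\<Sum>i<n. M (\<alpha> i))" for n
      by (intro symmetric_op_sum effect_symmetric eff_i)
    have effP: "effect (\<Sum>i<n. M (\<alpha> i))" for n
      unfolding effect_def
    proof (intro conjI allI sym)
      fix x
      have eq: "inner ((\<Sum>i<n. M (\<alpha> i)) x) x = (\<Sum>i<n. inner (M (\<alpha> i) x) x)"
        by (simp add: blinfun.sum_left inner_sum_left)
      show "0 \<le> inner ((\<Sum>i<n. M (\<alpha> i)) x) x"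
        unfolding eq by (intro sum_nonneg effect_nonneg eff_i)
      have "(\<lambda>i. inner (M (\<alpha> i) x) x) sums inner (M (\<Union>i. \<alpha> i) x) x"
        using bounded_linear.sums[OF bounded_linear_inner_left sums] .
      then have "(\<Sum>i<n. inner (M (\<alpha> i) x) x) \<le> inner (M (\<Union>i. \<alpha> i) x) x"
        by (metis effect_nonneg[OF eff_i] finite_lessThan sum_le_suminf sums_summable sums_unique)
      also have "\<dots> \<le> inner x x" by (rule effect_le[OF Un])
      finally show "inner ((\<Sum>i<n. M (\<alpha> i)) x) x \<le> inner x x" by (simp only: eq)
    qed
    show "limitin weak_star_topology (\<lambda>n. \<Sum>i<n. M (\<alpha> i)) (M (\<Union>i. \<alpha> i)) sequentially"
    proof (rule limitin_weak_star_of_strong)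
      show "(\<Sum>i<n. M (\<alpha> i)) \<in> bounded_ops" for n using sym by (simp add: symmetric_op_def)
      show "M (\<Union>i. \<alpha> i) \<in> bounded_ops" using Un by (simp add: effect_def symmetric_op_def)
      show "norm ((\<Sum>i<n. M (\<alpha> i)) x) \<le> norm x" for n x by (rule effect_norm_le[OF effP])
      show "(\<lambda>n. (\<Sum>i<n. M (\<alpha> i)) x) \<longlonglongrightarrow> M (\<Union>i. \<alpha> i) x" for x
        using sums[of x] by (simp add: sums_def blinfun.sum_left)
    qed
  qed
qed

lemma effect_measureD:
  assumes "effect_measure N M"
  shows "\<alpha> \<in> sets N \<Longrightarrow> effect (M \<alpha>)" "M (space N) = id_blinfun"
    "range \<alpha>' \<subseteq> sets N \<Longrightarrow> disjoint_family \<alpha>' \<Longrightarrow>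
      (\<lambda>i. blinfun_apply (M (\<alpha>' i)) x) sums blinfun_apply (M (\<Union>i :: nat. \<alpha>' i)) x"
  using assms by (auto simp: effect_measure_def)

lemma effect_measure_empty:
  assumes "effect_measure N M" shows "M {} = 0"
proof (rule blinfun_eqI)
  fix x
  have "(\<lambda>i :: nat. M {} x) sums M (\<Union>i :: nat. {}) x"
    by (rule effect_measureD(3)[OF assms]) (auto simp: disjoint_family_on_def)
  then have "(\<lambda>i :: nat. M {} x) \<longlonglongrightarrow> 0"
    by (intro summable_LIMSEQ_zero) (rule sums_summable)
  then show "M {} x = blinfun_apply 0 x" by (simp add: LIMSEQ_const_iff)
qed

lemma effect_measure_Un:
  assumes M: "effect_measure N M" and "\<alpha> \<in> sets N" "\<beta> \<in> sets N" "\<alpha> \<inter> \<beta> = {}"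
  shows "M (\<alpha> \<union> \<beta>) = M \<alpha> + M \<beta>"
proof (rule blinfun_eqI)
  fix x
  have "(\<lambda>i. M (binaryset \<alpha> \<beta> i) x) sums M (\<Union>i. binaryset \<alpha> \<beta> i) x"
    using assms(2-) by (intro effect_measureD(3)[OF M])
      (auto simp: range_binaryset_eq disjoint_family_on_def binaryset_def)
  moreover have "(\<lambda>i. M (binaryset \<alpha> \<beta> i) x) sums (M \<alpha> x + M \<beta> x)"
    by (rule binaryset_sums) (simp add: effect_measure_empty[OF M])
  ultimately show "M (\<alpha> \<union> \<beta>) x = (M \<alpha> + M \<beta>) x"
    using sums_unique2 by (fastforce simp: UN_binaryset_eq blinfun.add_left)
qed

lemma effect_measure_compl:
  assumes M: "effect_measure N M" and \<alpha>: "\<alpha> \<in> sets N"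
  shows "M (space N - \<alpha>) = id_blinfun - M \<alpha>"
proof -
  have "\<alpha> \<union> (space N - \<alpha>) = space N" using sets.sets_into_space[OF \<alpha>] by blast
  then have "M \<alpha> + M (space N - \<alpha>) = id_blinfun"
    using effect_measure_Un[OF M \<alpha>, of "space N - \<alpha>"] \<alpha> effect_measureD(2)[OF M] by auto
  then show ?thesis by (simp add: algebra_simps)
qed

section \<open>Regularity of finite Borel measures and Borel sets of a product\<close>

text \<open>Open sets are F_\<sigma>: by regularity each point of U has a basic neighbourhood whose
  closure stays inside U, and there are only countably many basic sets.\<close>

lemma openin_eq_countable_Union_closedin:
  assumes "second_countable A" "regular_space A" "openin A U"
  obtains K :: "nat \<Rightarrow> 'a set" where "\<And>n. closedin A (K n)" "U = (\<Union>n. K n)"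
proof -
  obtain \<B> where \<B>: "countable \<B>" "\<And>V. V \<in> \<B> \<Longrightarrow> openin A V"
    "\<And>U x. openin A U \<Longrightarrow> x \<in> U \<Longrightarrow> \<exists>V\<in>\<B>. x \<in> V \<and> V \<subseteq> U"
    using assms(1) unfolding second_countable_def by metis
  \<comment> \<open>The empty set is added to make the family nonempty, so that
    \<open>from_nat_into\<close> enumerates exactly it.\<close>
  define \<K> where "\<K> = insert {} ((\<lambda>V. A closure_of V) ` {V \<in> \<B>. A closure_of V \<subseteq> U})"
  have "countable \<K>" unfolding \<K>_def by (intro countable_insert countable_image) (auto intro: countable_subset[OF _ \<B>(1)])
  moreover have "\<K> \<noteq> {}" by (simp add: \<K>_def)
  ultimately have range: "range (from_nat_into \<K>) = \<K>" by simp
  have "U \<subseteq> \<Union>\<K>"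
  proof
    fix x assume x: "x \<in> U"
    then obtain V W where VW: "openin A V" "closedin A W" "x \<in> V" "V \<subseteq> W" "W \<subseteq> U"
      using assms(2,3) unfolding neighbourhood_base_of_closedin[symmetric] neighbourhood_base_of by metis
    then obtain V' where V': "V' \<in> \<B>" "x \<in> V'" "V' \<subseteq> V" using \<B>(3) by blast
    then have "A closure_of V' \<subseteq> W" using VW by (intro closure_of_minimal) auto
    moreover have "V' \<subseteq> A closure_of V'" using V' \<B>(2) by (intro closure_of_subset openin_subset) auto
    ultimately have "A closure_of V' \<in> \<K>" "x \<in> A closure_of V'" using V' VW by (auto simp: \<K>_def)
    then show "x \<in> \<Union>\<K>" by blast
  qed
  moreover have "\<Union>\<K> \<subseteq> U" by (auto simp: \<K>_def)
  ultimately have "U = \<Union>\<K>" by blast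
  moreover have "closedin A (from_nat_into \<K> n)" for n
    using from_nat_into[OF \<open>\<K> \<noteq> {}\<close>, of n] by (auto simp: \<K>_def)
  ultimately show ?thesis using that[of "from_nat_into \<K>"] by (simp add: range)
qed

text \<open>The sets that can be approximated in this way form a \<sigma>-algebra containing the
  open sets. Complements are immediate, since complementing C and U swaps their roles and leaves the
  gap \<open>U - C\<close> unchanged.\<close>

lemma finite_borel_measure_regular:
  assumes A: "second_countable A" "regular_space A"
    and N: "finite_measure N" "sets N = sets (borel_of A)"
    and \<alpha>: "\<alpha> \<in> sets (borel_of A)" and e: "0 < e"
  obtains C U where "closedin A C" "openin A U" "C \<subseteq> \<alpha>" "\<alpha> \<subseteq> U" "measure N (U - C) < e"
proof -
  interpret finite_measure N by (rule N)
  have op: "openin A U \<Longrightarrow> U \<in> sets N" for U by (simp add: N openin_in_borel_of)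
  have cl: "closedin A U \<Longrightarrow> U \<in> sets N" for U by (simp add: N closedin_in_borel_of)
  have "\<forall>e>0. \<exists>C U. closedin A C \<and> openin A U \<and> C \<subseteq> \<alpha> \<and> \<alpha> \<subseteq> U \<and> measure N (U - C) < e"
    using \<alpha> unfolding sets_borel_of
  proof (induction \<alpha> rule: sigma_sets.induct)
    case (Basic U)
    then have U: "openin A U" by simp
    obtain K where K: "\<And>n :: nat. closedin A (K n)" "U = (\<Union>n. K n)"
      using openin_eq_countable_Union_closedin[OF A U] by blast
    define F where "F n = (\<Union>i\<le>n. K i)" for n
    have F: "closedin A (F n)" for n unfolding F_def using K by (intro closedin_Union) auto
    have "(\<lambda>n. measure N (U - F n)) \<longlonglongrightarrow> measure N (\<Inter>n. U - F n)"
    proof (rule finite_Lim_measure_decseq)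
      show "decseq (\<lambda>n. U - F n)" unfolding F_def
        by (rule decseq_SucI) (auto simp: le_Suc_eq)
    qed (use op[OF U] cl[OF F] in auto)
    moreover have "(\<Inter>n. U - F n) = {}" unfolding K(2) F_def by auto
    ultimately have lim: "(\<lambda>n. measure N (U - F n)) \<longlonglongrightarrow> 0" by (simp only: measure_empty)
    show ?case
    proof (intro allI impI)
      fix e :: real assume "0 < e"
      then obtain n where "measure N (U - F n) < e"
        using eventually_happens[OF order_tendstoD(2)[OF lim]] by (auto simp: trivial_limit_sequentially)
      moreover have "F n \<subseteq> U" unfolding K(2) F_def by auto
      ultimately show "\<exists>C V. closedin A C \<and> openin A V \<and> C \<subseteq> U \<and> U \<subseteq> V \<and> measure N (V - C) < e"
        using U F by blast
    qed
  next
    case Empty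
    show ?case
    proof (intro allI impI)
      fix e :: real assume "0 < e"
      then have "measure N ({} - {}) < e" by simp
      then show "\<exists>C U. closedin A C \<and> openin A U \<and> C \<subseteq> {} \<and> {} \<subseteq> U \<and> measure N (U - C) < e"
        using closedin_empty openin_empty by blast
    qed
  next
    case (Compl a)
    show ?case
    proof (intro allI impI)
      fix e :: real assume "0 < e"
      then obtain C U where CU: "closedin A C" "openin A U" "C \<subseteq> a" "a \<subseteq> U" "measure N (U - C) < e"
        using Compl.IH by metis
      have eq: "(topspace A - C) - (topspace A - U) = U - C" using openin_subset[OF CU(2)] by blast
      have "closedin A (topspace A - U)" "openin A (topspace A - C)" using CU(1,2) by auto
      moreover have "topspace A - U \<subseteq> topspace A - a" "topspace A - a \<subseteq> topspace A - C" using CU(3,4) by blast+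
      moreover have "measure N ((topspace A - C) - (topspace A - U)) < e" unfolding eq by (rule CU(5))
      ultimately show "\<exists>C U. closedin A C \<and> openin A U \<and> C \<subseteq> topspace A - a \<and> topspace A - a \<subseteq> U \<and> measure N (U - C) < e"
        by blast
    qed
  next
    case (Union a)
    show ?case
    proof (intro allI impI)
      fix e :: real assume e: "0 < e"
      \<comment> \<open>These tolerances sum to e / 2, which leaves room for replacing the countable
        union of closed sets by a finite one.\<close>
      have "\<forall>i. \<exists>C U. closedin A C \<and> openin A U \<and> C \<subseteq> a i \<and> a i \<subseteq> U \<and> measure N (U - C) < e / 2 * (1/2) ^ Suc i"
        by (intro allI Union.IH[rule_format]) (use e in simp)
      then obtain C U where CU: "\<And>i. closedin A (C i)" "\<And>i. openin A (U i)" "\<And>i. C i \<subseteq> a i" "\<And>i. a i \<subseteq> U i"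
        "\<And>i. measure N (U i - C i) < e / 2 * (1/2) ^ Suc i" by metis
      \<comment> \<open>A countable union of closed sets need not be closed; continuity from above
        along \<open>D\<close> finds a finite union that is large enough.\<close>
      define D where "D n = (\<Union>i. U i) - (\<Union>i\<le>n. C i)" for n :: nat
      have cC: "closedin A (\<Union>i\<le>n. C i)" for n :: nat using CU by (intro closedin_Union) auto
      have oU: "openin A (\<Union>i. U i)" using CU by (intro openin_Union) auto
      have geo: "(\<lambda>i. e / 2 * (1/2) ^ Suc i) sums (e / 2)"
        using sums_mult[OF power_half_series, of "e / 2"] by simp
      have sm: "summable (\<lambda>i. measure N (U i - C i))"
        by (rule summable_comparison_test'[OF sums_summable[OF geo]]) (simp only: real_norm_def abs_of_nonneg[OF measure_nonneg] less_imp_le[OF CU(5)])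
      have "measure N (\<Union>i. U i - C i) \<le> (\<Sum>i. measure N (U i - C i))"
        using CU by (intro finite_measure_subadditive_countably sm) (auto intro: op cl)
      also have "\<dots> \<le> (\<Sum>i. e / 2 * (1/2) ^ Suc i)"
        by (rule suminf_le[OF less_imp_le[OF CU(5)] sm sums_summable[OF geo]])
      also have "\<dots> = e / 2" using sums_unique[OF geo] by simp
      finally have "measure N (\<Union>i. U i - C i) \<le> e / 2" .
      moreover have "measure N (\<Inter>n. D n) \<le> measure N (\<Union>i. U i - C i)"
      proof (rule finite_measure_mono)
        show "(\<Union>i. U i - C i) \<in> sets N"
          using CU by (intro sets.countable_UN image_subsetI sets.Diff op cl) auto
      qed (auto simp: D_def)
      ultimately have "measure N (\<Inter>n. D n) < e" using e by linarith
      moreover have "(\<lambda>n. measure N (D n)) \<longlonglongrightarrow> measure N (\<Inter>n. D n)"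
      proof (rule finite_Lim_measure_decseq)
        show "range D \<subseteq> sets N" unfolding D_def using op[OF oU] cl[OF cC] by auto
        show "decseq D" unfolding D_def by (rule decseq_SucI) (auto simp: le_Suc_eq)
      qed
      ultimately obtain n where "measure N (D n) < e"
        using eventually_happens[OF order_tendstoD(2)] by (metis trivial_limit_sequentially)
      moreover have "(\<Union>i\<le>n. C i) \<subseteq> (\<Union>i. a i)" "(\<Union>i. a i) \<subseteq> (\<Union>i. U i)" using CU(3,4) by blast+
      ultimately show "\<exists>C U. closedin A C \<and> openin A U \<and> C \<subseteq> (\<Union>i. a i) \<and> (\<Union>i. a i) \<subseteq> U \<and> measure N (U - C) < e"
        using oU cC[of n] unfolding D_def by metis
    qed
  qed
  with e that show ?thesis by metis
qed

lemma continuous_map_measurable_borel_of: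
  assumes "continuous_map X Y f"
  shows "f \<in> measurable (borel_of X) (borel_of Y)"
proof (rule measurable_sigma_sets[OF sets_borel_of])
  show "f \<in> space (borel_of X) \<rightarrow> topspace Y" using assms by (auto simp: continuous_map_def)
  fix U assume "U \<in> {U. openin Y U}"
  then have "openin X {x \<in> topspace X. f x \<in> U}" using assms by (simp add: continuous_map_def)
  moreover have "{x \<in> topspace X. f x \<in> U} = f -` U \<inter> space (borel_of X)" by auto
  ultimately show "f -` U \<inter> space (borel_of X) \<in> sets (borel_of X)" by (metis openin_in_borel_of)
qed (auto dest: openin_subset)

text \<open>Countable bases make every open set of the product a countable union of open rectangles,
  which gives one inclusion; the other is Borel measurability of the two projections.\<close>

lemma sets_borel_of_prod_topology:
  assumes "second_countable A" "second_countable B"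
  shows "sets (borel_of (prod_topology A B)) = sets (borel_of A \<Otimes>\<^sub>M borel_of B)"
proof (rule subset_antisym)
  obtain \<A> where \<A>: "countable \<A>" "\<And>V. V \<in> \<A> \<Longrightarrow> openin A V"
    "\<And>U x. openin A U \<Longrightarrow> x \<in> U \<Longrightarrow> \<exists>V\<in>\<A>. x \<in> V \<and> V \<subseteq> U"
    using assms(1) unfolding second_countable_def by metis
  obtain \<B> where \<B>: "countable \<B>" "\<And>V. V \<in> \<B> \<Longrightarrow> openin B V"
    "\<And>U x. openin B U \<Longrightarrow> x \<in> U \<Longrightarrow> \<exists>V\<in>\<B>. x \<in> V \<and> V \<subseteq> U"
    using assms(2) unfolding second_countable_def by metis
  have "W \<in> sets (borel_of A \<Otimes>\<^sub>M borel_of B)" if W: "openin (prod_topology A B) W" for W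
  proof -
    let ?R = "{(U, V) \<in> \<A> \<times> \<B>. U \<times> V \<subseteq> W}"
    have "W = (\<Union>(U, V)\<in>?R. U \<times> V)"
    proof
      show "W \<subseteq> (\<Union>(U, V)\<in>?R. U \<times> V)"
      proof clarify
        fix x y assume "(x, y) \<in> W"
        then obtain U V where UV: "openin A U" "openin B V" "x \<in> U" "y \<in> V" "U \<times> V \<subseteq> W"
          using W unfolding openin_prod_topology_alt by metis
        then obtain U' V' where "U' \<in> \<A>" "x \<in> U'" "U' \<subseteq> U" "V' \<in> \<B>" "y \<in> V'" "V' \<subseteq> V"
          using \<A>(3) \<B>(3) by metis
        with UV show "(x, y) \<in> (\<Union>(U, V)\<in>?R. U \<times> V)" by (intro UN_I[of "(U', V')"]) auto
      qed
    qed auto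
    also have "\<dots> \<in> sets (borel_of A \<Otimes>\<^sub>M borel_of B)"
    proof (rule sets.countable_UN')
      show "countable ?R" using \<A>(1) \<B>(1) by (intro countable_subset[of ?R "\<A> \<times> \<B>"]) auto
      show "(\<lambda>(U, V). U \<times> V) ` ?R \<subseteq> sets (borel_of A \<Otimes>\<^sub>M borel_of B)"
        using \<A>(2) \<B>(2) by (auto intro!: pair_measureI openin_in_borel_of)
    qed
    finally show ?thesis .
  qed
  then show "sets (borel_of (prod_topology A B)) \<subseteq> sets (borel_of A \<Otimes>\<^sub>M borel_of B)"
    unfolding sets_borel_of[of "prod_topology A B"]
    using sets.sigma_sets_subset[of "{U. openin (prod_topology A B) U}" "borel_of A \<Otimes>\<^sub>M borel_of B"]
    by (auto simp: space_pair_measure)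
  have "fst \<in> measurable (borel_of (prod_topology A B)) (borel_of A)"
    "snd \<in> measurable (borel_of (prod_topology A B)) (borel_of B)"
    by (auto intro!: continuous_map_measurable_borel_of continuous_map_fst continuous_map_snd)
  then have "(\<lambda>p. (fst p, snd p)) \<in> measurable (borel_of (prod_topology A B)) (borel_of A \<Otimes>\<^sub>M borel_of B)"
    by (rule measurable_Pair)
  then have id: "id \<in> measurable (borel_of (prod_topology A B)) (borel_of A \<Otimes>\<^sub>M borel_of B)"
    by (simp add: id_def)
  show "sets (borel_of A \<Otimes>\<^sub>M borel_of B) \<subseteq> sets (borel_of (prod_topology A B))"
  proof
    fix S assume S: "S \<in> sets (borel_of A \<Otimes>\<^sub>M borel_of B)"
    then have "S \<subseteq> topspace A \<times> topspace B"
      using sets.sets_into_space[OF S] by (simp add: space_pair_measure)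
    then have "id -` S \<inter> space (borel_of (prod_topology A B)) = S" by auto
    then show "S \<in> sets (borel_of (prod_topology A B))" using measurable_sets[OF id S] by simp
  qed
qed

section \<open>Bimeasures on compact spaces\<close>

text \<open>Only finite additivity is required here; countable additivity is derived in
  \<open>bimeasure_extends\<close> from the margins.\<close>

locale biadditive =
  fixes M :: "'a measure" and N :: "'b measure" and b :: "'a set \<Rightarrow> 'b set \<Rightarrow> real"
  assumes nonneg: "\<And>\<alpha> \<beta>. \<alpha> \<in> sets M \<Longrightarrow> \<beta> \<in> sets N \<Longrightarrow> 0 \<le> b \<alpha> \<beta>"
    and add_left: "\<And>\<alpha> \<alpha>' \<beta>. \<alpha> \<in> sets M \<Longrightarrow> \<alpha>' \<in> sets M \<Longrightarrow> \<alpha> \<inter> \<alpha>' = {} \<Longrightarrow> \<beta> \<in> sets N \<Longrightarrow>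
      b (\<alpha> \<union> \<alpha>') \<beta> = b \<alpha> \<beta> + b \<alpha>' \<beta>"
    and add_right: "\<And>\<alpha> \<beta> \<beta>'. \<alpha> \<in> sets M \<Longrightarrow> \<beta> \<in> sets N \<Longrightarrow> \<beta>' \<in> sets N \<Longrightarrow> \<beta> \<inter> \<beta>' = {} \<Longrightarrow>
      b \<alpha> (\<beta> \<union> \<beta>') = b \<alpha> \<beta> + b \<alpha> \<beta>'"
begin

lemma empty_left: "\<beta> \<in> sets N \<Longrightarrow> b {} \<beta> = 0"
  using add_left[of "{}" "{}" \<beta>] by simp

lemma empty_right: "\<alpha> \<in> sets M \<Longrightarrow> b \<alpha> {} = 0"
  using add_right[of \<alpha> "{}" "{}"] by simp

lemma sum_left:
  assumes "finite J" "\<And>j. j \<in> J \<Longrightarrow> P j \<in> sets M" "disjoint_family_on P J" "\<beta> \<in> sets N"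
  shows "b (\<Union>j\<in>J. P j) \<beta> = (\<Sum>j\<in>J. b (P j) \<beta>)"
  using assms
proof (induction J rule: finite_induct)
  case (insert j J)
  have "P j \<inter> (\<Union>j\<in>J. P j) = {}" using insert by (auto simp: disjoint_family_on_def)
  moreover have "(\<Union>j\<in>J. P j) \<in> sets M" using insert by (intro sets.finite_UN) auto
  moreover have "disjoint_family_on P J" using insert.prems by (auto simp: disjoint_family_on_def)
  ultimately show ?case using insert by (simp add: add_left)
qed (simp add: empty_left)

lemma sum_right:
  assumes "finite J" "\<And>j. j \<in> J \<Longrightarrow> P j \<in> sets N" "disjoint_family_on P J" "\<alpha> \<in> sets M"
  shows "b \<alpha> (\<Union>j\<in>J. P j) = (\<Sum>j\<in>J. b \<alpha> (P j))"
  using assms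
proof (induction J rule: finite_induct)
  case (insert j J)
  have "P j \<inter> (\<Union>j\<in>J. P j) = {}" using insert by (auto simp: disjoint_family_on_def)
  moreover have "(\<Union>j\<in>J. P j) \<in> sets N" using insert by (intro sets.finite_UN) auto
  moreover have "disjoint_family_on P J" using insert.prems by (auto simp: disjoint_family_on_def)
  ultimately show ?case using insert by (simp add: add_right)
qed (simp add: empty_right)

text \<open>Both families are refined to the atoms of the finite algebras that they generate.\<close>

lemma sum_nonneg_of_pointwise:
  assumes I: "finite I" and D: "\<And>i. i \<in> I \<Longrightarrow> D i \<in> sets M" and T: "\<And>i. i \<in> I \<Longrightarrow> T i \<in> sets N"
    and pointwise: "\<And>x y. x \<in> space M \<Longrightarrow> y \<in> space N \<Longrightarrow>
      0 \<le> (\<Sum>i\<in>I. c i * (indicator (D i) x * indicator (T i) y))"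
  shows "0 \<le> (\<Sum>i\<in>I. c i * b (D i) (T i))"
proof -
  \<comment> \<open>\<open>P J\<close> is the atom of points that lie in \<open>D i\<close> exactly
    for those i in I that belong to J; \<open>Q\<close> does the same for the sets
    \<open>T i\<close>.\<close>
  define P where "P J = {x \<in> space M. \<forall>i\<in>I. x \<in> D i \<longleftrightarrow> i \<in> J}" for J
  define Q where "Q J = {y \<in> space N. \<forall>i\<in>I. y \<in> T i \<longleftrightarrow> i \<in> J}" for J
  have P: "P J \<in> sets M" for J
    unfolding P_def
  proof (rule sets.sets_Collect_finite_All[OF _ I])
    fix i assume i: "i \<in> I"
    then have "{x \<in> space M. x \<in> D i \<longleftrightarrow> i \<in> J} = (if i \<in> J then D i else space M - D i)"
      using sets.sets_into_space[OF D[OF i]] by auto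
    then show "{x \<in> space M. x \<in> D i \<longleftrightarrow> i \<in> J} \<in> sets M" using D[OF i] by simp
  qed
  have Q: "Q J \<in> sets N" for J
    unfolding Q_def
  proof (rule sets.sets_Collect_finite_All[OF _ I])
    fix i assume i: "i \<in> I"
    then have "{y \<in> space N. y \<in> T i \<longleftrightarrow> i \<in> J} = (if i \<in> J then T i else space N - T i)"
      using sets.sets_into_space[OF T[OF i]] by auto
    then show "{y \<in> space N. y \<in> T i \<longleftrightarrow> i \<in> J} \<in> sets N" using T[OF i] by simp
  qed
  have "b (D i) (T i) = (\<Sum>J\<in>Pow I. \<Sum>K\<in>Pow I. b (P J) (Q K) * (indicator J i * indicator K i))"
    if i: "i \<in> I" for i
  proof -
    let ?I = "{J \<in> Pow I. i \<in> J}"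
    have fin: "finite ?I" using I by simp
    have ind: "indicator J i = (if i \<in> J then 1 else 0 :: real)" for J by simp
    have Di: "D i = (\<Union>J\<in>?I. P J)"
    proof
      show "D i \<subseteq> (\<Union>J\<in>?I. P J)"
      proof
        fix x assume "x \<in> D i"
        then have "x \<in> P {k \<in> I. x \<in> D k}" using sets.sets_into_space[OF D[OF i]] by (auto simp: P_def)
        with \<open>x \<in> D i\<close> i show "x \<in> (\<Union>J\<in>?I. P J)" by (intro UN_I[of "{k \<in> I. x \<in> D k}"]) auto
      qed
    qed (use i in \<open>auto simp: P_def\<close>)
    have Ti: "T i = (\<Union>J\<in>?I. Q J)"
    proof
      show "T i \<subseteq> (\<Union>J\<in>?I. Q J)"
      proof
        fix x assume "x \<in> T i"
        then have "x \<in> Q {k \<in> I. x \<in> T k}" using sets.sets_into_space[OF T[OF i]] by (auto simp: Q_def)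
        with \<open>x \<in> T i\<close> i show "x \<in> (\<Union>J\<in>?I. Q J)" by (intro UN_I[of "{k \<in> I. x \<in> T k}"]) auto
      qed
    qed (use i in \<open>auto simp: Q_def\<close>)
    have disj: "disjoint_family_on P ?I" "disjoint_family_on Q ?I"
      unfolding disjoint_family_on_def P_def Q_def by blast+
    have "b (D i) (T i) = (\<Sum>J\<in>?I. b (P J) (T i))"
      unfolding Di by (rule sum_left[OF fin P disj(1) T[OF i]])
    also have "\<dots> = (\<Sum>J\<in>?I. \<Sum>K\<in>?I. b (P J) (Q K))"
      unfolding Ti by (intro sum.cong refl sum_right[OF fin Q disj(2) P])
    also have "\<dots> = (\<Sum>J\<in>Pow I. if i \<in> J then \<Sum>K\<in>Pow I. if i \<in> K then b (P J) (Q K) else 0 else 0)"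
      using I by (simp only: sum.inter_filter finite_Pow_iff)
    also have "\<dots> = (\<Sum>J\<in>Pow I. indicator J i * (\<Sum>K\<in>Pow I. indicator K i * b (P J) (Q K)))"
      by (intro sum.cong refl) (auto intro!: sum.cong simp: ind)
    finally show ?thesis by (simp add: sum_distrib_left mult_ac)
  qed
  then have "(\<Sum>i\<in>I. c i * b (D i) (T i)) =
      (\<Sum>i\<in>I. \<Sum>J\<in>Pow I. \<Sum>K\<in>Pow I. b (P J) (Q K) * (c i * (indicator J i * indicator K i)))"
    by (simp add: sum_distrib_left mult_ac)
  also have "\<dots> = (\<Sum>J\<in>Pow I. \<Sum>i\<in>I. \<Sum>K\<in>Pow I. b (P J) (Q K) * (c i * (indicator J i * indicator K i)))"
    by (rule sum.swap)
  also have "\<dots> = (\<Sum>J\<in>Pow I. \<Sum>K\<in>Pow I. \<Sum>i\<in>I. b (P J) (Q K) * (c i * (indicator J i * indicator K i)))"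
    by (intro sum.cong refl sum.swap)
  also have "\<dots> = (\<Sum>J\<in>Pow I. \<Sum>K\<in>Pow I. b (P J) (Q K) * (\<Sum>i\<in>I. c i * (indicator J i * indicator K i)))"
    by (simp only: sum_distrib_left)
  also have "0 \<le> \<dots>"
  proof (intro sum_nonneg)
    fix J K
    show "0 \<le> b (P J) (Q K) * (\<Sum>i\<in>I. c i * (indicator J i * indicator K i))"
    \<comment> \<open>The coefficient of a pair of nonempty atoms is the value of the given function
      at any point of their product, hence nonnegative. If one atom is empty, \<open>b\<close>
      vanishes.\<close>
    proof (cases "P J = {} \<or> Q K = {}")
      case True
      then show ?thesis using P Q empty_left empty_right by auto
    next
      case False
      then obtain x y where "x \<in> P J" "y \<in> Q K" by blast
      then have "(\<Sum>i\<in>I. c i * (indicator J i * indicator K i)) =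
          (\<Sum>i\<in>I. c i * (indicator (D i) x * indicator (T i) y))" and "x \<in> space M" "y \<in> space N"
        by (auto simp: P_def Q_def indicator_def intro!: sum.cong)
      then show ?thesis using pointwise P Q by (simp add: nonneg)
    qed
  qed
  finally show ?thesis .
qed

text \<open>An inequality between indicator functions passes to \<open>b\<close>. The index
  \<open>None\<close> stands for the large rectangle with coefficient 1, the indices
  \<open>Some i\<close> for the pieces with coefficient -1; \<open>subadditive\<close> reverses the
  signs.\<close>

lemma superadditive:
  assumes "finite I" "\<And>i. i \<in> I \<Longrightarrow> D i \<in> sets M" "\<And>i. i \<in> I \<Longrightarrow> T i \<in> sets N"
    and "\<delta> \<in> sets M" "\<theta> \<in> sets N"
    and disj: "disjoint_family_on (\<lambda>i. D i \<times> T i) I" and sub: "(\<Union>i\<in>I. D i \<times> T i) \<subseteq> \<delta> \<times> \<theta>"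
  shows "(\<Sum>i\<in>I. b (D i) (T i)) \<le> b \<delta> \<theta>"
proof -
  let ?I = "insert None (Some ` I)"
  let ?D = "case_option \<delta> D" and ?T = "case_option \<theta> T" and ?c = "case_option 1 (\<lambda>_. -1) :: _ \<Rightarrow> real"
  have sum: "(\<Sum>i\<in>?I. h i) = h None + (\<Sum>i\<in>I. h (Some i))" for h :: "_ \<Rightarrow> real"
    using assms(1) by (subst sum.insert) (auto simp: sum.reindex)
  have "0 \<le> (\<Sum>i\<in>?I. ?c i * b (?D i) (?T i))"
  proof (rule sum_nonneg_of_pointwise)
    fix x y
    have "(\<Sum>i\<in>I. indicator (D i) x * indicator (T i) y :: real) = (\<Sum>i\<in>I. indicator (D i \<times> T i) (x, y))"
      by (simp add: indicator_times)
    also have "\<dots> = indicator (\<Union>i\<in>I. D i \<times> T i) (x, y)"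
      using assms(1) disj by (simp only: indicator_UN_disjoint)
    also have "\<dots> \<le> indicator (\<delta> \<times> \<theta>) (x, y)" using sub by (intro indicator_leI) blast
    also have "\<dots> = indicator \<delta> x * indicator \<theta> y" by (simp add: indicator_times)
    finally show "0 \<le> (\<Sum>i\<in>?I. ?c i * (indicator (?D i) x * indicator (?T i) y))"
      by (simp only: sum option.case) (simp add: sum_negf)
  qed (use assms in auto)
  then show ?thesis by (simp only: sum option.case) (simp add: sum_negf)
qed

lemma subadditive:
  assumes "finite I" "\<And>i. i \<in> I \<Longrightarrow> D i \<in> sets M" "\<And>i. i \<in> I \<Longrightarrow> T i \<in> sets N"
    and "\<delta> \<in> sets M" "\<theta> \<in> sets N"
    and sub: "\<delta> \<times> \<theta> \<subseteq> (\<Union>i\<in>I. D i \<times> T i)"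
  shows "b \<delta> \<theta> \<le> (\<Sum>i\<in>I. b (D i) (T i))"
proof -
  let ?I = "insert None (Some ` I)"
  let ?D = "case_option \<delta> D" and ?T = "case_option \<theta> T" and ?c = "case_option (-1) (\<lambda>_. 1) :: _ \<Rightarrow> real"
  have sum: "(\<Sum>i\<in>?I. h i) = h None + (\<Sum>i\<in>I. h (Some i))" for h :: "_ \<Rightarrow> real"
    using assms(1) by (subst sum.insert) (auto simp: sum.reindex)
  have "0 \<le> (\<Sum>i\<in>?I. ?c i * b (?D i) (?T i))"
  proof (rule sum_nonneg_of_pointwise)
    fix x y
    have "indicator \<delta> x * indicator \<theta> y \<le> (\<Sum>i\<in>I. indicator (D i) x * indicator (T i) y :: real)"
    proof (cases "x \<in> \<delta> \<and> y \<in> \<theta>")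
      case True
      then obtain i where i: "i \<in> I" "x \<in> D i" "y \<in> T i" using sub by blast
      then have "(1 :: real) = indicator (D i) x * indicator (T i) y" by simp
      also have "\<dots> \<le> (\<Sum>i\<in>I. indicator (D i) x * indicator (T i) y)"
        using i assms(1) by (intro member_le_sum) auto
      finally show ?thesis using True by simp
    next
      case False
      then have "indicator \<delta> x * indicator \<theta> y = (0 :: real)" by (auto simp: indicator_def)
      then show ?thesis by (simp only:) (simp add: sum_nonneg)
    qed
    then show "0 \<le> (\<Sum>i\<in>?I. ?c i * (indicator (?D i) x * indicator (?T i) y))"
      by (simp only: sum option.case) simp
  qed (use assms in auto)
  then show ?thesis by (simp only: sum option.case) simp
qed

text \<open>The smaller rectangle and two full strips cover the larger one. The strips are measured
  by the margins, so approximating each side separately approximates the rectangle.\<close>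

lemma le_add_margins:
  assumes "\<delta> \<in> sets M" "\<delta>' \<in> sets M" "\<theta> \<in> sets N" "\<theta>' \<in> sets N" "\<delta>' \<subseteq> \<delta>" "\<theta>' \<subseteq> \<theta>"
  shows "b \<delta> \<theta> \<le> b \<delta>' \<theta>' + b (\<delta> - \<delta>') (space N) + b (space M) (\<theta> - \<theta>')"
proof -
  let ?D = "\<lambda>i. [\<delta>', \<delta> - \<delta>', space M] ! i" and ?T = "\<lambda>i. [\<theta>', space N, \<theta> - \<theta>'] ! i"
  have three: "{..<3} = {0, 1, 2 :: nat}" by auto
  have "b \<delta> \<theta> \<le> (\<Sum>i\<in>{..<3}. b (?D i) (?T i))"
  proof (rule subadditive)
    show "\<delta> \<times> \<theta> \<subseteq> (\<Union>i<3. ?D i \<times> ?T i)"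
      using assms sets.sets_into_space[OF assms(1)] sets.sets_into_space[OF assms(3)]
      unfolding three by auto
  qed (use assms in \<open>auto simp: three\<close>)
  then show ?thesis unfolding three by simp
qed

lemma semiring_rectangles:
  "semiring_of_sets (space M \<times> space N) {\<alpha> \<times> \<beta> | \<alpha> \<beta>. \<alpha> \<in> sets M \<and> \<beta> \<in> sets N}"
    (is "semiring_of_sets _ ?R")
proof
  have I: "\<alpha> \<times> \<beta> \<in> ?R" if "\<alpha> \<in> sets M" "\<beta> \<in> sets N" for \<alpha> \<beta> using that by blast
  show "?R \<subseteq> Pow (space M \<times> space N)" by (auto dest: sets.sets_into_space)
  show "{} \<in> ?R" using I[of "{}" "{}"] by simp
  fix p q assume "p \<in> ?R" "q \<in> ?R"
  then obtain \<alpha> \<beta> \<gamma> \<delta> where pq: "p = \<alpha> \<times> \<beta>" "q = \<gamma> \<times> \<delta>"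
    and s: "\<alpha> \<in> sets M" "\<beta> \<in> sets N" "\<gamma> \<in> sets M" "\<delta> \<in> sets N" by blast
  have "p \<inter> q = (\<alpha> \<inter> \<gamma>) \<times> (\<beta> \<inter> \<delta>)" unfolding pq by blast
  then show "p \<inter> q \<in> ?R" using s by (simp only: I sets.Int)
  let ?C = "{\<alpha> \<times> (\<beta> - \<delta>), (\<alpha> - \<gamma>) \<times> (\<beta> \<inter> \<delta>)}"
  have "?C \<subseteq> ?R" using s by (simp only: insert_subset I sets.Int sets.Diff empty_subsetI simp_thms)
  moreover have "disjoint ?C" by (auto simp: disjoint_def)
  moreover have "p - q = \<Union>?C" unfolding pq by auto
  moreover have "finite ?C" by simp
  ultimately show "\<exists>C\<subseteq>?R. finite C \<and> disjoint C \<and> p - q = \<Union>C"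
    by (intro exI[of _ ?C] conjI)
qed

end

text \<open>Regularity of the margins gives countable additivity on rectangles: a rectangle is approximated
  from inside by a compact one, and the rectangles covering it from outside by open ones.\<close>

lemma bimeasure_extends:
  fixes A :: "'a topology" and B :: "'b topology"
  assumes A: "second_countable A" "compact_space A" "Hausdorff_space A"
    and B: "second_countable B" "compact_space B" "Hausdorff_space B"
    and bi: "biadditive (borel_of A) (borel_of B) b"
    and NA: "finite_measure NA" "sets NA = sets (borel_of A)" "\<And>\<alpha>. \<alpha> \<in> sets (borel_of A) \<Longrightarrow> b \<alpha> (topspace B) = measure NA \<alpha>"
    and NB: "finite_measure NB" "sets NB = sets (borel_of B)" "\<And>\<beta>. \<beta> \<in> sets (borel_of B) \<Longrightarrow> b (topspace A) \<beta> = measure NB \<beta>"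
  obtains \<mu> where "sets \<mu> = sets (borel_of A \<Otimes>\<^sub>M borel_of B)"
    "\<And>\<alpha> \<beta>. \<alpha> \<in> sets (borel_of A) \<Longrightarrow> \<beta> \<in> sets (borel_of B) \<Longrightarrow> emeasure \<mu> (\<alpha> \<times> \<beta>) = ennreal (b \<alpha> \<beta>)"
proof -
  interpret biadditive "borel_of A" "borel_of B" b by (rule bi)
  note regA = finite_borel_measure_regular[OF A(1) compact_Hausdorff_imp_regular_space[OF A(2,3)] NA(1,2)]
  note regB = finite_borel_measure_regular[OF B(1) compact_Hausdorff_imp_regular_space[OF B(2,3)] NB(1,2)]
  let ?SA = "sets (borel_of A)" and ?SB = "sets (borel_of B)"
  have sums: "(\<lambda>n. b (D n) (T n)) sums b \<delta> \<theta>"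
    if DT: "\<And>n. D n \<in> ?SA" "\<And>n. T n \<in> ?SB" and dt: "\<delta> \<in> ?SA" "\<theta> \<in> ?SB"
      and disj: "disjoint_family (\<lambda>n. D n \<times> T n)" and Un: "(\<Union>n. D n \<times> T n) = \<delta> \<times> \<theta>"
    for D :: "nat \<Rightarrow> 'a set" and T :: "nat \<Rightarrow> 'b set" and \<delta> \<theta>
  proof -
    have le: "(\<Sum>i<n. b (D i) (T i)) \<le> b \<delta> \<theta>" for n
      using disj by (intro superadditive DT dt) (auto simp: disjoint_family_on_def simp flip: Un)
    have summ: "summable (\<lambda>i. b (D i) (T i))"
      by (rule bounded_imp_summable[where B = "b \<delta> \<theta>"])
         (simp_all only: nonneg DT le flip: lessThan_Suc_atMost)
    let ?S = "\<Sum>i. b (D i) (T i)"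
    have "b \<delta> \<theta> \<le> ?S + e" if "0 < e" for e
    proof -
      \<comment> \<open>Shrinking the large rectangle costs at most 2 * r and enlarging the pieces
        at most another 2 * r, so the total of 4 * r stays below e.\<close>
      define r where "r = e / 6"
      have r: "0 < r" using that by (simp add: r_def)
      have geo: "(\<lambda>i. r * (1/2) ^ Suc i) sums r"
        using sums_mult[OF power_half_series, of r] by simp
      obtain C U' where C: "closedin A C" "C \<subseteq> \<delta>" "measure NA (U' - C) < r" "openin A U'" "\<delta> \<subseteq> U'"
        using regA[OF dt(1) r] by metis
      obtain L V' where L: "closedin B L" "L \<subseteq> \<theta>" "measure NB (V' - L) < r" "openin B V'" "\<theta> \<subseteq> V'"
        using regB[OF dt(2) r] by metis
      have "measure NA (\<delta> - C) \<le> measure NA (U' - C)"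
        using C dt by (intro finite_measure.finite_measure_mono NA)
          (auto simp: NA openin_in_borel_of closedin_in_borel_of)
      moreover have "measure NB (\<theta> - L) \<le> measure NB (V' - L)"
        using L dt by (intro finite_measure.finite_measure_mono NB)
          (auto simp: NB openin_in_borel_of closedin_in_borel_of)
      moreover have "b \<delta> \<theta> \<le> b C L + b (\<delta> - C) (topspace B) + b (topspace A) (\<theta> - L)"
        using le_add_margins[of \<delta> C \<theta> L] dt C L by (simp add: closedin_in_borel_of)
      ultimately have 1: "b \<delta> \<theta> \<le> b C L + 2 * r"
        using C(1,3) L(1,3) dt by (simp add: NA(3) NB(3) closedin_in_borel_of sets.Diff)
      \<comment> \<open>The tolerances sum to r over all n, so every finite subfamily that
        compactness may select stays within the budget.\<close>
      have "\<exists>U. openin A U \<and> D n \<subseteq> U \<and> measure NA (U - D n) < r * (1/2) ^ Suc n" for n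
      proof -
        obtain C U where CU: "closedin A C" "openin A U" "C \<subseteq> D n" "D n \<subseteq> U" "measure NA (U - C) < r * (1/2) ^ Suc n"
          using regA[OF DT(1)[of n], of "r * (1/2) ^ Suc n"] r by auto
        have "measure NA (U - D n) \<le> measure NA (U - C)"
          using CU DT by (intro finite_measure.finite_measure_mono NA)
            (auto simp: NA openin_in_borel_of closedin_in_borel_of)
        with CU show ?thesis by (intro exI[of _ U]) simp
      qed
      then obtain U where U: "\<And>n. openin A (U n)" "\<And>n. D n \<subseteq> U n" "\<And>n. measure NA (U n - D n) < r * (1/2) ^ Suc n"
        by metis
      have "\<exists>U. openin B U \<and> T n \<subseteq> U \<and> measure NB (U - T n) < r * (1/2) ^ Suc n" for n
      proof -
        obtain C U where CU: "closedin B C" "openin B U" "C \<subseteq> T n" "T n \<subseteq> U" "measure NB (U - C) < r * (1/2) ^ Suc n"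
          using regB[OF DT(2)[of n], of "r * (1/2) ^ Suc n"] r by auto
        have "measure NB (U - T n) \<le> measure NB (U - C)"
          using CU DT by (intro finite_measure.finite_measure_mono NB)
            (auto simp: NB openin_in_borel_of closedin_in_borel_of)
        with CU show ?thesis by (intro exI[of _ U]) simp
      qed
      then obtain V where V: "\<And>n. openin B (V n)" "\<And>n. T n \<subseteq> V n" "\<And>n. measure NB (V n - T n) < r * (1/2) ^ Suc n"
        by metis
      have UV: "b (U n) (V n) \<le> b (D n) (T n) + 2 * (r * (1/2) ^ Suc n)" for n
      proof -
        have "b (U n) (V n) \<le> b (D n) (T n) + b (U n - D n) (topspace B) + b (topspace A) (V n - T n)"
          using le_add_margins[of "U n" "D n" "V n" "T n"] U V DT by (simp add: openin_in_borel_of)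
        moreover have "b (U n - D n) (topspace B) = measure NA (U n - D n)"
          "b (topspace A) (V n - T n) = measure NB (V n - T n)"
          using U V DT by (auto intro!: NA(3) NB(3) simp: openin_in_borel_of)
        ultimately show ?thesis using U(3)[of n] V(3)[of n] by linarith
      qed
      \<comment> \<open>Compactness reduces the countable open cover to a finite one, to which the
        finite inequality \<open>subadditive\<close> applies.\<close>
      have "compactin (prod_topology A B) (C \<times> L)"
        using C L A B by (auto simp: compactin_Times closedin_compact_space)
      moreover have "C \<times> L \<subseteq> \<Union>(range (\<lambda>n. U n \<times> V n))"
      proof -
        have "C \<times> L \<subseteq> \<delta> \<times> \<theta>" using C L by blast
        also have "\<dots> \<subseteq> \<Union>(range (\<lambda>n. U n \<times> V n))" unfolding Un[symmetric] using U(2) V(2) by blast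
        finally show ?thesis .
      qed
      moreover have "openin (prod_topology A B) W" if "W \<in> range (\<lambda>n. U n \<times> V n)" for W
        using that U(1) V(1) by (auto simp: openin_prod_Times_iff)
      ultimately have "\<exists>\<F>. finite \<F> \<and> \<F> \<subseteq> range (\<lambda>n. U n \<times> V n) \<and> C \<times> L \<subseteq> \<Union>\<F>"
        by (intro compactinD) assumption+
      then obtain \<F> where F: "finite \<F>" "\<F> \<subseteq> range (\<lambda>n. U n \<times> V n)" "C \<times> L \<subseteq> \<Union>\<F>"
        by (elim exE conjE)
      obtain I where "finite I" "\<F> = (\<lambda>n. U n \<times> V n) ` I"
        using finite_subset_image[OF F(1,2)] by (elim exE conjE)
      with F(3) have I: "finite I" "C \<times> L \<subseteq> (\<Union>n\<in>I. U n \<times> V n)" by simp_all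
      have "b C L \<le> (\<Sum>n\<in>I. b (U n) (V n))"
        using I C L U V by (intro subadditive) (auto simp: openin_in_borel_of closedin_in_borel_of)
      also have "\<dots> \<le> (\<Sum>n\<in>I. b (D n) (T n) + 2 * (r * (1/2) ^ Suc n))"
        by (intro sum_mono UV)
      also have "\<dots> = (\<Sum>n\<in>I. b (D n) (T n)) + 2 * (\<Sum>n\<in>I. r * (1/2) ^ Suc n)"
        by (simp only: sum.distrib sum_distrib_left)
      also have "\<dots> \<le> ?S + 2 * r"
      proof -
        have "(\<Sum>n\<in>I. b (D n) (T n)) \<le> ?S"
          by (rule sum_le_suminf[OF summ I(1)]) (simp add: nonneg DT)
        moreover have "(\<Sum>n\<in>I. r * (1/2) ^ Suc n) \<le> (\<Sum>n. r * (1/2) ^ Suc n)"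
          by (rule sum_le_suminf[OF sums_summable[OF geo] I(1)]) (use r in simp)
        ultimately show ?thesis using sums_unique[OF geo] by linarith
      qed
      finally show ?thesis using 1 r by (simp add: r_def)
    qed
    then have "b \<delta> \<theta> \<le> ?S" by (rule field_le_epsilon)
    moreover have "?S \<le> b \<delta> \<theta>" by (rule suminf_le_const[OF summ le])
    ultimately show ?thesis using summ by (simp add: sums_iff)
  qed
  define P where "P \<alpha> \<beta> \<longleftrightarrow> \<alpha> \<in> ?SA \<and> \<beta> \<in> ?SB" for \<alpha> \<beta>
  define \<mu> where "\<mu> = extend_measure (topspace A \<times> topspace B) {(\<alpha>, \<beta>). P \<alpha> \<beta>}
    (\<lambda>(\<alpha>, \<beta>). \<alpha> \<times> \<beta>) (\<lambda>(\<alpha>, \<beta>). ennreal (b \<alpha> \<beta>))"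
  have img: "(\<lambda>(\<alpha>, \<beta>). \<alpha> \<times> \<beta>) ` {(\<alpha>, \<beta>). P \<alpha> \<beta>} = {\<alpha> \<times> \<beta> | \<alpha> \<beta>. \<alpha> \<in> ?SA \<and> \<beta> \<in> ?SB}"
    by (auto simp: P_def)
  show ?thesis
  proof
    show "sets \<mu> = sets (borel_of A \<Otimes>\<^sub>M borel_of B)"
      unfolding \<mu>_def
    proof (subst sets_extend_measure)
      show "(\<lambda>(\<alpha>, \<beta>). \<alpha> \<times> \<beta>) ` {(\<alpha>, \<beta>). P \<alpha> \<beta>} \<subseteq> Pow (topspace A \<times> topspace B)"
        unfolding img by (auto dest: sets_borel_of_subset)
    qed (simp only: img sets_pair_measure space_borel_of)
    fix \<alpha> \<beta> assume \<alpha>\<beta>: "\<alpha> \<in> ?SA" "\<beta> \<in> ?SB"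
    show "emeasure \<mu> (\<alpha> \<times> \<beta>) = ennreal (b \<alpha> \<beta>)"
    proof (rule extend_measure_caratheodory_pair[OF \<mu>_def])
      show "P \<alpha> \<beta>" using \<alpha>\<beta> by (simp add: P_def)
      show "semiring_of_sets (topspace A \<times> topspace B) {\<alpha> \<times> \<beta> | \<alpha> \<beta>. P \<alpha> \<beta>}"
        unfolding P_def using semiring_rectangles by simp
      show e: "ennreal (b i j) = 0" if "P i j" "i \<times> j = {}" for i j
        using that empty_left empty_right by (auto simp: P_def)
      \<comment> \<open>The value must depend on the rectangle as a set: a nonempty rectangle
        determines its sides, and all empty ones have value 0.\<close>
      show "ennreal (b i j) = ennreal (b k l)" if "P i j" "P k l" "i \<times> j = k \<times> l" for i j k l
      proof (cases "i \<times> j = {}")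
        case True
        then show ?thesis using e[OF that(1)] e[OF that(2)] that(3) by simp
      next
        case False
        then show ?thesis using that(3) by (auto simp: times_eq_iff)
      qed
      fix D :: "nat \<Rightarrow> 'a set" and T :: "nat \<Rightarrow> 'b set" and \<delta> \<theta>
      assume *: "\<And>n. P (D n) (T n)" "P \<delta> \<theta>" "disjoint_family (\<lambda>n. D n \<times> T n)" "(\<Union>n. D n \<times> T n) = \<delta> \<times> \<theta>"
      then have "(\<lambda>n. b (D n) (T n)) sums b \<delta> \<theta>" by (intro sums) (auto simp: P_def)
      then show "(\<Sum>n. ennreal (b (D n) (T n))) = ennreal (b \<delta> \<theta>)"
        using * by (intro suminf_ennreal_eq) (auto simp: P_def nonneg)
    qed simp
  qed
qed

section \<open>Products of commuting quantum probability measures\<close>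

lemma effect_measure_cong_sets:
  "sets N = sets N' \<Longrightarrow> effect_measure N M \<longleftrightarrow> effect_measure N' M"
  by (simp add: effect_measure_def sets_eq_imp_space_eq[of N N'])

text \<open>Supplies the margins for \<open>bimeasure_extends\<close>: with the whole space on one
  side, the product form reduces to that of a single factor.\<close>

lemma effect_measure_scalar:
  assumes M: "effect_measure N M"
  obtains K where "finite_measure K" "sets K = sets N"
    "\<And>\<alpha>. \<alpha> \<in> sets N \<Longrightarrow> measure K \<alpha> = inner (blinfun_apply (M \<alpha>) x) x"
proof -
  define m where "m \<alpha> = ennreal (inner (M \<alpha> x) x)" for \<alpha>
  define K where "K = measure_of (space N) (sets N) m"
  have nonneg: "0 \<le> inner (M \<alpha> x) x" if "\<alpha> \<in> sets N" for \<alpha>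
    using that by (intro effect_nonneg effect_measureD(1)[OF M])
  have sets: "sets K = sets N" "space K = space N" by (simp_all add: K_def)
  have emeasure: "emeasure K \<alpha> = ennreal (inner (M \<alpha> x) x)" if "\<alpha> \<in> sets N" for \<alpha>
  proof -
    have "countably_additive (sets K) m"
      unfolding countably_additive_def m_def sets
    proof (intro allI impI suminf_ennreal_eq)
      fix \<alpha> :: "nat \<Rightarrow> 'a set" assume \<alpha>: "range \<alpha> \<subseteq> sets N" "disjoint_family \<alpha>"
      show "0 \<le> inner (M (\<alpha> i) x) x" for i using \<alpha> by (intro nonneg) auto
      show "(\<lambda>i. inner (M (\<alpha> i) x) x) sums inner (M (\<Union>i. \<alpha> i) x) x"
        by (rule bounded_linear.sums[OF bounded_linear_inner_left effect_measureD(3)[OF M \<alpha>]])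
    qed
    moreover have "positive (sets K) m"
      by (simp add: positive_def m_def effect_measure_empty[OF M])
    ultimately show ?thesis
      using emeasure_measure_of[OF K_def sets.space_closed, of \<alpha>] that by (simp add: m_def sets)
  qed
  show ?thesis
  proof
    show "finite_measure K" by standard (simp add: emeasure sets)
    show "sets K = sets N" by (rule sets)
    show "measure K \<alpha> = inner (M \<alpha> x) x" if "\<alpha> \<in> sets N" for \<alpha>
      using that by (simp add: Sigma_Algebra.measure_def emeasure nonneg)
  qed
qed

text \<open>Dynkin's theorem for the intersection-stable system of rectangles; the empty set is
  itself a rectangle and needs no separate case. Existence, uniqueness, idempotence and
  measurability all rest on this rule.\<close>

lemma pair_measure_induct_disjoint [consumes 1, case_names basic compl union]:
  assumes S: "S \<in> sets (M \<Otimes>\<^sub>M N)"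
    and basic: "\<And>\<alpha> \<beta>. \<alpha> \<in> sets M \<Longrightarrow> \<beta> \<in> sets N \<Longrightarrow> P (\<alpha> \<times> \<beta>)"
    and compl: "\<And>S. S \<in> sets (M \<Otimes>\<^sub>M N) \<Longrightarrow> P S \<Longrightarrow> P (space (M \<Otimes>\<^sub>M N) - S)"
    and union: "\<And>S :: nat \<Rightarrow> _. disjoint_family S \<Longrightarrow> range S \<subseteq> sets (M \<Otimes>\<^sub>M N) \<Longrightarrow> (\<And>i. P (S i)) \<Longrightarrow> P (\<Union>i. S i)"
  shows "P S"
  using Int_stable_pair_measure_generator[of M N] pair_measure_closed[of M N] S[unfolded sets_pair_measure]
proof (induction rule: sigma_sets_induct_disjoint)
  case (basic S) then show ?case using assms(2) by auto
next
  case empty show ?case using assms(2)[of "{}" "{}"] by simp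
next
  case (compl S) then show ?case using assms(3)[of S] by (simp add: sets_pair_measure space_pair_measure)
next
  case (union S) then show ?case using assms(4)[of S] by (simp add: sets_pair_measure)
qed

lemma product_effect_measure_exists:
  fixes A :: "'a topology" and B :: "'b topology"
    and E :: "'a set \<Rightarrow> 'h :: complex_hilbert_space \<Rightarrow>\<^sub>L 'h"
  assumes A: "second_countable A" "compact_space A" "Hausdorff_space A"
    and B: "second_countable B" "compact_space B" "Hausdorff_space B"
    and E: "effect_measure (borel_of A) E" and F: "effect_measure (borel_of B) F"
    and comm: "\<And>\<alpha> \<beta>. \<alpha> \<in> sets (borel_of A) \<Longrightarrow> \<beta> \<in> sets (borel_of B) \<Longrightarrow> E \<alpha> o\<^sub>L F \<beta> = F \<beta> o\<^sub>L E \<alpha>"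
  shows "\<exists>G. effect_measure (borel_of A \<Otimes>\<^sub>M borel_of B) G \<and>
    (\<forall>\<alpha>\<in>sets (borel_of A). \<forall>\<beta>\<in>sets (borel_of B). G (\<alpha> \<times> \<beta>) = E \<alpha> o\<^sub>L F \<beta>)"
proof -
  let ?SA = "sets (borel_of A)" and ?SB = "sets (borel_of B)" and ?N = "borel_of A \<Otimes>\<^sub>M borel_of B"
  have eff: "effect (E \<alpha> o\<^sub>L F \<beta>)" if "\<alpha> \<in> ?SA" "\<beta> \<in> ?SB" for \<alpha> \<beta>
    using that by (intro effect_compose comm effect_measureD(1)[OF E] effect_measureD(1)[OF F])
  have "\<exists>\<mu>. sets \<mu> = sets ?N \<and> (\<forall>\<alpha>\<in>?SA. \<forall>\<beta>\<in>?SB. emeasure \<mu> (\<alpha> \<times> \<beta>) = ennreal (inner (E \<alpha> (F \<beta> x)) x))" for x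
  proof -
    let ?b = "\<lambda>\<alpha> \<beta>. inner (E \<alpha> (F \<beta> x)) x"
    have bi: "biadditive (borel_of A) (borel_of B) ?b"
    proof
      show "0 \<le> ?b \<alpha> \<beta>" if "\<alpha> \<in> ?SA" "\<beta> \<in> ?SB" for \<alpha> \<beta>
        using effect_nonneg[OF eff[OF that], of x] by simp
    qed (simp_all add: effect_measure_Un[OF E] effect_measure_Un[OF F] blinfun.add_left blinfun.add_right inner_add_left)
    have top: "E (topspace A) = id_blinfun" "F (topspace B) = id_blinfun"
      using effect_measureD(2)[OF E] effect_measureD(2)[OF F] by simp_all
    obtain NA where NA: "finite_measure NA" "sets NA = ?SA" "\<And>\<alpha>. \<alpha> \<in> ?SA \<Longrightarrow> measure NA \<alpha> = inner (E \<alpha> x) x"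
      using effect_measure_scalar[OF E, of x] by blast
    obtain NB where NB: "finite_measure NB" "sets NB = ?SB" "\<And>\<beta>. \<beta> \<in> ?SB \<Longrightarrow> measure NB \<beta> = inner (F \<beta> x) x"
      using effect_measure_scalar[OF F, of x] by blast
    obtain \<mu> where \<mu>: "sets \<mu> = sets ?N" "\<And>\<alpha> \<beta>. \<alpha> \<in> ?SA \<Longrightarrow> \<beta> \<in> ?SB \<Longrightarrow> emeasure \<mu> (\<alpha> \<times> \<beta>) = ennreal (?b \<alpha> \<beta>)"
      by (rule bimeasure_extends[OF A B bi NA(1,2) _ NB(1,2)]) (simp_all add: NA(3) NB(3) top)
    then show ?thesis by (intro exI[of _ \<mu>]) simp
  qed
  then obtain \<mu> where sets: "\<And>x. sets (\<mu> x) = sets ?N"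
    and emeasure: "\<And>x \<alpha> \<beta>. \<alpha> \<in> ?SA \<Longrightarrow> \<beta> \<in> ?SB \<Longrightarrow> emeasure (\<mu> x) (\<alpha> \<times> \<beta>) = ennreal (inner (E \<alpha> (F \<beta> x)) x)"
    by metis
  have space: "space (\<mu> x) = topspace A \<times> topspace B" for x
    using sets_eq_imp_space_eq[OF sets[of x]] by (simp add: space_pair_measure)
  have measure: "measure (\<mu> x) (\<alpha> \<times> \<beta>) = inner ((E \<alpha> o\<^sub>L F \<beta>) x) x" if "\<alpha> \<in> ?SA" "\<beta> \<in> ?SB" for x \<alpha> \<beta>
    using effect_nonneg[OF eff[OF that], of x] by (simp add: Sigma_Algebra.measure_def emeasure that)
  have "E (topspace A) o\<^sub>L F (topspace B) = id_blinfun"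
    using effect_measureD(2)[OF E] effect_measureD(2)[OF F] by (intro blinfun_eqI) simp
  then have total: "measure (\<mu> x) (space (\<mu> x)) = inner x x" for x
    unfolding space by (subst measure) simp_all
  have fin: "finite_measure (\<mu> x)" for x
    by standard (simp add: space emeasure)
  \<comment> \<open>A complement is represented by \<open>id_blinfun - T\<close>, a disjoint union
    by a monotone limit; the total mass \<open>inner x x\<close> bounds the partial sums that this
    limit requires.\<close>
  have "\<exists>T. effect T \<and> (\<forall>x. inner (blinfun_apply T x) x = measure (\<mu> x) S)" if "S \<in> sets ?N" for S
    using that
  proof (induction rule: pair_measure_induct_disjoint)
    case (basic \<alpha> \<beta>) then show ?case using eff measure by metis
  next
    case (compl S)
    then obtain T where T: "effect T" "\<And>x. inner (T x) x = measure (\<mu> x) S" by blast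
    have "measure (\<mu> x) (space (\<mu> x) - S) = inner x x - measure (\<mu> x) S" for x
      using finite_measure.finite_measure_compl[OF fin[of x], of S] compl by (simp add: sets total)
    then have "inner ((id_blinfun - T) x) x = measure (\<mu> x) (space ?N - S)" for x
      by (simp add: T space space_pair_measure blinfun.diff_left inner_diff_left)
    with effect_complement[OF T(1)] show ?case by blast
  next
    case (union S)
    then obtain T where T: "\<And>i. effect (T i)" "\<And>i x. inner (T i x) x = measure (\<mu> x) (S i)" by metis
    have sums: "(\<lambda>i. inner (T i x) x) sums measure (\<mu> x) (\<Union>i. S i)" for x
      unfolding T using union by (intro finite_measure.finite_measure_UNION fin) (simp_all add: sets)
    have "(\<Sum>i<n. inner (T i x) x) \<le> inner x x" for n x
    proof -
      have "(\<Sum>i<n. inner (T i x) x) \<le> (\<Sum>i. inner (T i x) x)"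
        by (rule sum_le_suminf[OF sums_summable[OF sums]]) (simp_all add: effect_nonneg T(1))
      also have "\<dots> = measure (\<mu> x) (\<Union>i. S i)" using sums_unique[OF sums] by simp
      also have "\<dots> \<le> inner x x"
        unfolding total[symmetric] by (rule finite_measure.bounded_measure[OF fin])
      finally show ?thesis .
    qed
    with T(1) obtain U where U: "effect U" "\<And>x. (\<lambda>i. T i x) sums U x"
      using effect_series_summable[of T] by blast
    have "inner (U x) x = measure (\<mu> x) (\<Union>i. S i)" for x
      using bounded_linear.sums[OF bounded_linear_inner_left U(2)] sums by (rule sums_unique2)
    with U(1) show ?case by blast
  qed
  then obtain G where G: "\<And>S. S \<in> sets ?N \<Longrightarrow> effect (G S)"
    "\<And>S x. S \<in> sets ?N \<Longrightarrow> inner (blinfun_apply (G S) x) x = measure (\<mu> x) S" by metis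
  show ?thesis
  proof (intro exI[of _ G] conjI ballI)
    show "G (\<alpha> \<times> \<beta>) = E \<alpha> o\<^sub>L F \<beta>" if "\<alpha> \<in> ?SA" "\<beta> \<in> ?SB" for \<alpha> \<beta>
      using that eff[OF that] by (intro symmetric_op_eqI effect_symmetric) (simp_all add: G pair_measureI measure)
    show "effect_measure ?N G"
      unfolding effect_measure_def
    proof (intro conjI ballI allI impI)
      have "space ?N \<in> sets ?N" by (rule sets.top)
      then show "G (space ?N) = id_blinfun"
        using total by (intro symmetric_op_eqI effect_symmetric symmetric_op_id) (simp_all add: G space space_pair_measure)
      fix S :: "nat \<Rightarrow> ('a \<times> 'b) set" and x
      assume S: "range S \<subseteq> sets ?N \<and> disjoint_family S"
      then have Si: "S i \<in> sets ?N" for i by auto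
      have Un: "(\<Union>i. S i) \<in> sets ?N" using Si by blast
      \<comment> \<open>The operators were chosen set by set. Their additivity is inherited from the
        measures \<open>\<mu> x\<close> through the quadratic forms and is then strengthened to
        strong convergence.\<close>
      show "(\<lambda>i. G (S i) x) sums G (\<Union>i. S i) x"
      proof (rule effect_series_sums)
        show "(\<lambda>i. inner (G (S i) x) x) sums inner (G (\<Union>i. S i) x) x" for x
          unfolding G(2)[OF Si] G(2)[OF Un]
          using S by (intro finite_measure.finite_measure_UNION fin) (simp_all add: sets)
      qed (use G Si Un in auto)
    qed (rule G)
  qed
qed

lemma effect_measure_pair_eqI:
  assumes G: "effect_measure (M \<Otimes>\<^sub>M N) G" and G': "effect_measure (M \<Otimes>\<^sub>M N) G'"
    and rect: "\<And>\<alpha> \<beta>. \<alpha> \<in> sets M \<Longrightarrow> \<beta> \<in> sets N \<Longrightarrow> G (\<alpha> \<times> \<beta>) = G' (\<alpha> \<times> \<beta>)"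
    and S: "S \<in> sets (M \<Otimes>\<^sub>M N)"
  shows "G S = G' S"
  using S
proof (induction rule: pair_measure_induct_disjoint)
  case (compl S)
  then show ?case using effect_measure_compl[OF G, of S] effect_measure_compl[OF G', of S] by simp
next
  case (union S)
  show ?case
  proof (rule blinfun_eqI)
    fix x
    have "(\<lambda>i. G (S i) x) sums G (\<Union>i. S i) x" by (rule effect_measureD(3)[OF G union(2,1)])
    moreover have "(\<lambda>i. G (S i) x) sums G' (\<Union>i. S i) x"
      unfolding union.IH by (rule effect_measureD(3)[OF G' union(2,1)])
    ultimately show "G (\<Union>i. S i) x = G' (\<Union>i. S i) x" by (rule sums_unique2)
  qed
qed (rule rect)

section \<open>Preservation of projections\<close>

lemma idempotent_effects_orthogonal:
  assumes P: "effect P" and Q: "effect Q" and PQ: "effect (P + Q)" and idem: "Q o\<^sub>L Q = Q"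
  shows "blinfun_apply P (blinfun_apply Q x) = 0"
proof -
  let ?y = "Q x"
  have y: "Q ?y = ?y" by (metis blinfun_apply_blinfun_compose idem)
  \<comment> \<open>On the range of Q, the bound P + Q \<le> 1 is already exhausted by Q and leaves
    nothing for P.\<close>
  have "inner ((P + Q) ?y) ?y \<le> inner ?y ?y" by (rule effect_le[OF PQ])
  then have "inner (P ?y) ?y \<le> 0" by (simp add: blinfun.add_left inner_add_left y)
  then have "(norm (P ?y))\<^sup>2 \<le> 0" using effect_norm_square_le[OF P, of ?y] by linarith
  then show ?thesis by simp
qed

text \<open>In the union case, idempotent values on disjoint sets are mutually orthogonal, so the
  product of the two series collapses to its diagonal.\<close>

lemma effect_measure_pair_idempotent:
  assumes G: "effect_measure (M \<Otimes>\<^sub>M N) G"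
    and rect: "\<And>\<alpha> \<beta>. \<alpha> \<in> sets M \<Longrightarrow> \<beta> \<in> sets N \<Longrightarrow> G (\<alpha> \<times> \<beta>) o\<^sub>L G (\<alpha> \<times> \<beta>) = G (\<alpha> \<times> \<beta>)"
    and S: "S \<in> sets (M \<Otimes>\<^sub>M N)"
  shows "G S o\<^sub>L G S = G S"
  using S
proof (induction rule: pair_measure_induct_disjoint)
  case (compl S)
  have "G S (G S x) = G S x" for x using compl.IH by (metis blinfun_apply_blinfun_compose)
  then show ?case unfolding effect_measure_compl[OF G compl(1)]
    by (intro blinfun_eqI) (simp add: blinfun.diff_left blinfun.diff_right)
next
  case (union S)
  have Si: "S i \<in> sets (M \<Otimes>\<^sub>M N)" for i using union by auto
  have orth: "G (S i) (G (S j) x) = (if j = i then G (S i) x else 0)" for i j x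
  proof (cases "i = j")
    case True
    then show ?thesis using union.IH by (metis blinfun_apply_blinfun_compose)
  next
    case False
    then have "S i \<inter> S j = {}" using union(1) by (auto simp: disjoint_family_on_def)
    then have "G (S i) + G (S j) = G (S i \<union> S j)" using effect_measure_Un[OF G Si Si] by simp
    moreover have "effect (G (S i \<union> S j))" using Si by (intro effect_measureD(1)[OF G] sets.Un)
    ultimately show ?thesis
      using False idempotent_effects_orthogonal[OF effect_measureD(1)[OF G Si] effect_measureD(1)[OF G Si], of i j x]
      union.IH by simp
  qed
  show ?case
  proof (rule blinfun_eqI)
    fix x
    have sums: "(\<lambda>i. G (S i) x) sums G (\<Union>i. S i) x" for x by (rule effect_measureD(3)[OF G union(2,1)])
    \<comment> \<open>\<open>G (S i)\<close> is continuous and may be applied termwise, and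
      orthogonality keeps only the term j = i. Summing over i at the vector
      \<open>G (\<Union>i. S i) x\<close> then gives idempotence.\<close>
    have "G (S i) (G (\<Union>j. S j) x) = G (S i) x" for i
    proof -
      have "(\<lambda>j. G (S i) (G (S j) x)) sums G (S i) (G (\<Union>j. S j) x)"
        by (rule bounded_linear.sums[OF blinfun.bounded_linear_right sums])
      moreover have "(\<lambda>j. G (S i) (G (S j) x)) sums G (S i) x"
        unfolding orth by (rule sums_single)
      ultimately show ?thesis by (rule sums_unique2)
    qed
    then have "(\<lambda>i. G (S i) x) sums G (\<Union>i. S i) (G (\<Union>i. S i) x)"
      using sums[of "G (\<Union>i. S i) x"] by simp
    then show "(G (\<Union>i. S i) o\<^sub>L G (\<Union>i. S i)) x = G (\<Union>i. S i) x"
      using sums[of x] sums_unique2 by simp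
  qed
qed (rule rect)

section \<open>Weak measurability and dependence on the channel inputs\<close>

lemma borel_measurable_norm_weak:
  fixes w :: "'z \<Rightarrow> 'h :: real_inner"
  assumes sep: "separable_space (euclidean :: 'h topology)"
    and w: "\<And>d. (\<lambda>z. inner (w z) d) \<in> borel_measurable Z"
  shows "(\<lambda>z. norm (w z)) \<in> borel_measurable Z"
  unfolding borel_measurable_iff_greater
proof
  fix a :: real
  obtain C :: "'h set" where C: "countable C" "closure C = UNIV"
    using sep unfolding separable_space_def by auto
  show "{z \<in> space Z. a < norm (w z)} \<in> sets Z"
  proof (cases "a < 0")
    case True
    then have "{z \<in> space Z. a < norm (w z)} = space Z" using norm_ge_zero less_le_trans by blast
    then show ?thesis by simp
  next
    case False
    \<comment> \<open>Without the restriction to C, u itself is a witness; the witnesses form an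
      open set, so the dense set C contains one too. Scaling by \<open>norm d\<close> avoids unit
      vectors, so density in the whole space suffices.\<close>
    have "a < norm u \<longleftrightarrow> (\<exists>d\<in>C. a * norm d < inner u d)" for u
    proof
      assume u: "a < norm u"
      let ?O = "{d. a * norm d < inner u d}"
      have "open ?O" by (intro open_Collect_less continuous_intros)
      moreover have "0 < norm u" using u False by linarith
      then have "u \<in> ?O"
        using u mult_strict_right_mono[of a "norm u" "norm u"] by (simp add: dot_square_norm power2_eq_square)
      ultimately have "?O \<inter> C \<noteq> {}"
        using C(2) open_Int_closure_eq_empty[of ?O C] by auto
      then show "\<exists>d\<in>C. a * norm d < inner u d" by auto
    next
      assume "\<exists>d\<in>C. a * norm d < inner u d"
      then obtain d where "a * norm d < inner u d" by blast
      also have "\<dots> \<le> norm u * norm d" by (rule norm_cauchy_schwarz)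
      finally show "a < norm u" by (rule mult_right_less_imp_less) simp
    qed
    then have "{z \<in> space Z. a < norm (w z)} = (\<Union>d\<in>C. {z \<in> space Z. a * norm d < inner (w z) d})" by auto
    also have "\<dots> \<in> sets Z"
      using w C(1) by (intro sets.countable_UN'') (simp_all add: borel_measurable_iff_greater)
    finally show ?thesis .
  qed
qed

text \<open>Joint measurability of \<open>inner (u z) (v z)\<close> is reduced by polarization to that of norms.\<close>

lemma borel_measurable_inner_weak:
  fixes u v :: "'z \<Rightarrow> 'h :: real_inner"
  assumes sep: "separable_space (euclidean :: 'h topology)"
    and u: "\<And>d. (\<lambda>z. inner (u z) d) \<in> borel_measurable Z"
    and v: "\<And>d. (\<lambda>z. inner (v z) d) \<in> borel_measurable Z"
  shows "(\<lambda>z. inner (u z) (v z)) \<in> borel_measurable Z"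
proof -
  have eq: "inner (u z) (v z) = ((norm (u z + v z))\<^sup>2 - (norm (u z - v z))\<^sup>2) / 4" for z
    by (simp add: power2_norm_eq_inner inner_simps inner_commute)
  have "(\<lambda>z. norm (u z + v z)) \<in> borel_measurable Z" "(\<lambda>z. norm (u z - v z)) \<in> borel_measurable Z"
    by (intro borel_measurable_norm_weak[OF sep]; simp only: inner_add_left inner_diff_left;
        intro borel_measurable_add borel_measurable_diff u v)+
  then show ?thesis
    unfolding eq by (intro borel_measurable_divide borel_measurable_diff borel_measurable_power borel_measurable_const)
qed

text \<open>The quantifier over \<eta> belongs to each side, because the imaginary part at \<eta> is
  the real inner product with \<open>\<i> *\<^sub>C \<eta>\<close>.\<close>

lemma cinner_measurable_iff:
  "(\<forall>\<eta>. (\<lambda>x. cinner (f x) \<eta>) \<in> borel_measurable M) \<longleftrightarrow> (\<forall>\<eta>. (\<lambda>x. inner (f x) \<eta>) \<in> borel_measurable M)"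
  by (auto simp: borel_measurable_complex_iff Re_cinner Im_cinner)

lemma info_channel_iff:
  "info_channel X A E \<longleftrightarrow>
     E \<in> extensional (topspace X) \<and>
     (\<forall>x\<in>topspace X. E x \<in> extensional (sets (borel_of A)) \<and> effect_measure (borel_of A) (E x)) \<and>
     (\<forall>\<alpha>\<in>sets (borel_of A). \<forall>\<xi> \<eta>. (\<lambda>x. inner (blinfun_apply (E x \<alpha>) \<xi>) \<eta>) \<in> borel_measurable (borel_of X))"
  unfolding info_channel_def cinner_measurable_iff by (auto simp: PiE_iff qpm_iff_effect_measure)

text \<open>On rectangles, symmetry moves \<open>E x \<alpha>\<close> to the second argument and so
  separates the variables: one vector depends only on y, the other only on x. Complements and unions
  then follow pointwise.\<close>

lemma product_channel_measurable:
  fixes G :: "'x \<times> 'y \<Rightarrow> ('a \<times> 'b) set \<Rightarrow> 'h :: complex_hilbert_space \<Rightarrow>\<^sub>L 'h"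
  assumes sep: "separable_space (euclidean :: 'h topology)"
    and G: "\<And>x y. x \<in> space X \<Longrightarrow> y \<in> space Y \<Longrightarrow> effect_measure (M \<Otimes>\<^sub>M N) (G (x, y))"
    and rect: "\<And>x y \<alpha> \<beta>. x \<in> space X \<Longrightarrow> y \<in> space Y \<Longrightarrow> \<alpha> \<in> sets M \<Longrightarrow> \<beta> \<in> sets N \<Longrightarrow>
      G (x, y) (\<alpha> \<times> \<beta>) = E x \<alpha> o\<^sub>L F y \<beta>"
    and E: "\<And>x \<alpha>. x \<in> space X \<Longrightarrow> \<alpha> \<in> sets M \<Longrightarrow> effect (E x \<alpha>)"
    and mE: "\<And>\<alpha> \<xi> \<eta>. \<alpha> \<in> sets M \<Longrightarrow> (\<lambda>x. inner (blinfun_apply (E x \<alpha>) \<xi>) \<eta>) \<in> borel_measurable X"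
    and mF: "\<And>\<beta> \<xi> \<eta>. \<beta> \<in> sets N \<Longrightarrow> (\<lambda>y. inner (blinfun_apply (F y \<beta>) \<xi>) \<eta>) \<in> borel_measurable Y"
    and S: "S \<in> sets (M \<Otimes>\<^sub>M N)"
  shows "(\<lambda>z. inner (blinfun_apply (G z S) \<xi>) \<eta>) \<in> borel_measurable (X \<Otimes>\<^sub>M Y)"
  using S
proof (induction arbitrary: \<xi> \<eta> rule: pair_measure_induct_disjoint)
  case (basic \<alpha> \<beta>)
  have "(\<lambda>z. inner (F (snd z) \<beta> \<xi>) (E (fst z) \<alpha> \<eta>)) \<in> borel_measurable (X \<Otimes>\<^sub>M Y)"
  proof (rule borel_measurable_inner_weak[OF sep])
    show "(\<lambda>z. inner (F (snd z) \<beta> \<xi>) d) \<in> borel_measurable (X \<Otimes>\<^sub>M Y)" for d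
      by (rule measurable_compose[OF measurable_snd mF[OF basic(2)]])
    show "(\<lambda>z. inner (E (fst z) \<alpha> \<eta>) d) \<in> borel_measurable (X \<Otimes>\<^sub>M Y)" for d
      by (rule measurable_compose[OF measurable_fst mE[OF basic(1)]])
  qed
  moreover have "inner (F (snd z) \<beta> \<xi>) (E (fst z) \<alpha> \<eta>) = inner (G z (\<alpha> \<times> \<beta>) \<xi>) \<eta>"
    if "z \<in> space (X \<Otimes>\<^sub>M Y)" for z
    using that basic effect_inner[OF E] rect by (auto simp: space_pair_measure)
  ultimately show ?case by (simp cong: measurable_cong)
next
  case (compl S)
  have "(\<lambda>z. inner \<xi> \<eta> - inner (G z S \<xi>) \<eta>) \<in> borel_measurable (X \<Otimes>\<^sub>M Y)"
    by (intro borel_measurable_diff borel_measurable_const compl.IH)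
  moreover have "inner \<xi> \<eta> - inner (G z S \<xi>) \<eta> = inner (G z (space (M \<Otimes>\<^sub>M N) - S) \<xi>) \<eta>"
    if "z \<in> space (X \<Otimes>\<^sub>M Y)" for z
    using that effect_measure_compl[OF G compl(1)]
    by (auto simp: space_pair_measure[of X Y] blinfun.diff_left inner_diff_left)
  ultimately show ?case by (simp cong: measurable_cong)
next
  case (union S)
  have "(\<lambda>z. \<Sum>i. inner (G z (S i) \<xi>) \<eta>) \<in> borel_measurable (X \<Otimes>\<^sub>M Y)"
    by (intro borel_measurable_suminf union.IH)
  moreover have "(\<Sum>i. inner (G z (S i) \<xi>) \<eta>) = inner (G z (\<Union>i. S i) \<xi>) \<eta>"
    if "z \<in> space (X \<Otimes>\<^sub>M Y)" for z
  proof -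
    have "effect_measure (M \<Otimes>\<^sub>M N) (G z)" using that G by (auto simp: space_pair_measure)
    then have "(\<lambda>i. G z (S i) \<xi>) sums G z (\<Union>i. S i) \<xi>" by (rule effect_measureD(3)) (rule union.hyps)+
    then show ?thesis by (intro sums_unique[symmetric] bounded_linear.sums[OF bounded_linear_inner_left])
  qed
  ultimately show ?case by (simp cong: measurable_cong)
qed

section \<open>Assembly of the product channel\<close>

theorem theorem3p4:
  fixes X :: "'x topology" and Y :: "'y topology"
    and A :: "'a topology" and B :: "'b topology"
    and E :: "'x \<Rightarrow> 'a set \<Rightarrow> 'h :: complex_hilbert_space \<Rightarrow>\<^sub>L 'h"
    and F :: "'y \<Rightarrow> 'b set \<Rightarrow> 'h \<Rightarrow>\<^sub>L 'h"
  assumes "second_countable X" "compact_space X" "Hausdorff_space X"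
    and "second_countable Y" "compact_space Y" "Hausdorff_space Y"
    and "second_countable A" "compact_space A" "Hausdorff_space A"
    and "second_countable B" "compact_space B" "Hausdorff_space B"
    and "separable_space (euclidean :: 'h topology)"
    and "info_channel X A E" and "info_channel Y B F"
    and "commuting_ranges X A Y B E F"
  shows "(\<exists>!G. is_product_channel X A Y B E F G) \<and>
    (projection_valued_channel X A E \<and> projection_valued_channel Y B F \<longrightarrow>
      (\<forall>G. is_product_channel X A Y B E F G \<longrightarrow>
        projection_valued_channel (prod_topology X Y) (prod_topology A B) G))"
proof -
  let ?XY = "prod_topology X Y" and ?AB = "prod_topology A B"
  let ?SA = "sets (borel_of A)" and ?SB = "sets (borel_of B)"
  note E = assms(14)[unfolded info_channel_iff] and F = assms(15)[unfolded info_channel_iff]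
  have effE: "effect_measure (borel_of A) (E x)" if "x \<in> topspace X" for x using E that by blast
  have effF: "effect_measure (borel_of B) (F y)" if "y \<in> topspace Y" for y using F that by blast
  have setsXY: "sets (borel_of ?XY) = sets (borel_of X \<Otimes>\<^sub>M borel_of Y)"
    by (rule sets_borel_of_prod_topology[OF assms(1,4)])
  have setsAB: "sets (borel_of ?AB) = sets (borel_of A \<Otimes>\<^sub>M borel_of B)"
    by (rule sets_borel_of_prod_topology[OF assms(7,10)])
  note eff_iff = effect_measure_cong_sets[OF setsAB]
  have "\<exists>G. effect_measure (borel_of A \<Otimes>\<^sub>M borel_of B) G \<and>
      (\<forall>\<alpha>\<in>?SA. \<forall>\<beta>\<in>?SB. G (\<alpha> \<times> \<beta>) = E x \<alpha> o\<^sub>L F y \<beta>)"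
    if xy: "x \<in> topspace X" "y \<in> topspace Y" for x y
  proof -
    have "E x \<alpha> o\<^sub>L F y \<beta> = F y \<beta> o\<^sub>L E x \<alpha>" if "\<alpha> \<in> ?SA" "\<beta> \<in> ?SB" for \<alpha> \<beta>
      using assms(16) xy that by (simp add: commuting_ranges_def)
    then show ?thesis
      by (intro product_effect_measure_exists assms(7-12) effE effF xy)
  qed
  then obtain g where g: "\<And>x y. x \<in> topspace X \<Longrightarrow> y \<in> topspace Y \<Longrightarrow>
      effect_measure (borel_of A \<Otimes>\<^sub>M borel_of B) (g x y)"
    and g_rect: "\<And>x y \<alpha> \<beta>. x \<in> topspace X \<Longrightarrow> y \<in> topspace Y \<Longrightarrow> \<alpha> \<in> ?SA \<Longrightarrow> \<beta> \<in> ?SB \<Longrightarrow>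
      g x y (\<alpha> \<times> \<beta>) = E x \<alpha> o\<^sub>L F y \<beta>" by metis
  \<comment> \<open>Both restrictions make G extensional, as a family and as a set function at each
    point, so that uniqueness can hold as equality of functions.\<close>
  define G where "G = (\<lambda>(x, y)\<in>topspace ?XY. restrict (g x y) (sets (borel_of ?AB)))"
  have G_eq: "G (x, y) S = g x y S" if "x \<in> topspace X" "y \<in> topspace Y" "S \<in> sets (borel_of ?AB)" for x y S
    using that by (simp add: G_def)
  have G: "effect_measure (borel_of A \<Otimes>\<^sub>M borel_of B) (G (x, y))" if "x \<in> topspace X" "y \<in> topspace Y" for x y
  proof -
    have "effect_measure (borel_of ?AB) (g x y)" using g[OF that] by (simp only: eff_iff)
    then have "effect_measure (borel_of ?AB) (G (x, y))"
      by (auto simp: effect_measure_def G_eq[OF that] sets.countable_UN simp del: space_borel_of)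
    then show ?thesis by (simp only: eff_iff)
  qed
  have G_rect: "G (x, y) (\<alpha> \<times> \<beta>) = E x \<alpha> o\<^sub>L F y \<beta>"
    if "x \<in> topspace X" "y \<in> topspace Y" "\<alpha> \<in> ?SA" "\<beta> \<in> ?SB" for x y \<alpha> \<beta>
    using that by (simp add: G_eq g_rect setsAB)
  have G_ext: "G \<in> extensional (topspace ?XY)" "\<And>z. z \<in> topspace ?XY \<Longrightarrow> G z \<in> extensional (sets (borel_of ?AB))"
    by (auto simp: G_def)
  have channel: "is_product_channel X A Y B E F G"
    unfolding is_product_channel_def info_channel_iff
  proof (intro conjI ballI allI)
    fix z assume z: "z \<in> topspace ?XY"
    then show "effect_measure (borel_of ?AB) (G z)" using G by (auto simp: eff_iff)
  next
    fix S \<xi> \<eta> assume "S \<in> sets (borel_of ?AB)"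
    then have S: "S \<in> sets (borel_of A \<Otimes>\<^sub>M borel_of B)" by (simp only: setsAB)
    have "(\<lambda>z. inner (G z S \<xi>) \<eta>) \<in> borel_measurable (borel_of X \<Otimes>\<^sub>M borel_of Y)"
    proof (rule product_channel_measurable[OF assms(13) _ _ _ _ _ S, where E = E and F = F])
      show "effect (E x \<alpha>)" if "x \<in> space (borel_of X)" "\<alpha> \<in> ?SA" for x \<alpha>
        using that effE effect_measureD(1) by (metis space_borel_of)
    qed (use E F in \<open>simp_all add: G G_rect\<close>)
    then show "(\<lambda>z. inner (G z S \<xi>) \<eta>) \<in> borel_measurable (borel_of ?XY)"
      by (simp only: measurable_cong_sets[OF setsXY refl])
  qed (use G_ext G_rect in auto)
  have unique: "G' = G" if G': "is_product_channel X A Y B E F G'" for G'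
  proof (rule extensionalityI[OF _ G_ext(1)])
    note G'_ch = G'[unfolded is_product_channel_def info_channel_iff]
    show "G' \<in> extensional (topspace ?XY)" using G'_ch by blast
    fix z assume z: "z \<in> topspace ?XY"
    then obtain x y where xy: "z = (x, y)" "x \<in> topspace X" "y \<in> topspace Y" by auto
    show "G' z = G z"
    proof (rule extensionalityI[OF _ G_ext(2)[OF z]])
      show "G' z \<in> extensional (sets (borel_of ?AB))" using G'_ch z by blast
      have eff': "effect_measure (borel_of A \<Otimes>\<^sub>M borel_of B) (G' z)"
        using G'_ch z by (simp only: eff_iff)
      fix S assume "S \<in> sets (borel_of ?AB)"
      then have S: "S \<in> sets (borel_of A \<Otimes>\<^sub>M borel_of B)" by (simp only: setsAB)
      show "G' z S = G z S"
        by (rule effect_measure_pair_eqI[OF eff' _ _ S]) (use G'_ch xy in \<open>simp_all add: G G_rect\<close>)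
    qed
  qed
  have "projection_valued_channel ?XY ?AB G'"
    if EP: "projection_valued_channel X A E" and FP: "projection_valued_channel Y B F"
      and G': "is_product_channel X A Y B E F G'" for G'
    unfolding projection_valued_channel_def spectral_measure_def
  proof (intro conjI ballI)
    show ch: "info_channel ?XY ?AB G'" using G' by (simp add: is_product_channel_def)
    fix z assume z: "z \<in> topspace ?XY"
    then obtain x y where xy: "z = (x, y)" "x \<in> topspace X" "y \<in> topspace Y" by auto
    show "qpm ?AB (G' z)" using ch z by (auto simp: info_channel_def)
    fix S assume S: "S \<in> sets (borel_of ?AB)"
    have eff': "effect_measure (borel_of A \<Otimes>\<^sub>M borel_of B) (G' z)"
      using ch z unfolding info_channel_iff by (simp only: eff_iff)
    have "G' z S o\<^sub>L G' z S = G' z S"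
    proof (rule effect_measure_pair_idempotent[OF eff'])
      fix \<alpha> \<beta> assume \<alpha>\<beta>: "\<alpha> \<in> ?SA" "\<beta> \<in> ?SB"
      have PQ: "E x \<alpha> o\<^sub>L E x \<alpha> = E x \<alpha>" "F y \<beta> o\<^sub>L F y \<beta> = F y \<beta>"
        using EP FP xy \<alpha>\<beta> by (auto simp: projection_valued_channel_def spectral_measure_def projections_iff)
      have comm: "E x \<alpha> o\<^sub>L F y \<beta> = F y \<beta> o\<^sub>L E x \<alpha>"
        using assms(16) xy \<alpha>\<beta> by (simp add: commuting_ranges_def)
      have eq: "G' z (\<alpha> \<times> \<beta>) = E x \<alpha> o\<^sub>L F y \<beta>"
        using G' xy \<alpha>\<beta> by (simp add: is_product_channel_def)
      \<comment> \<open>Commutation brings equal factors together, and each square collapses: E F E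
        F = E E F F = E F.\<close>
      have "E x \<alpha> (F y \<beta> (E x \<alpha> (F y \<beta> v))) = E x \<alpha> (F y \<beta> v)" for v
        using PQ comm by (metis blinfun_apply_blinfun_compose)
      then show "G' z (\<alpha> \<times> \<beta>) o\<^sub>L G' z (\<alpha> \<times> \<beta>) = G' z (\<alpha> \<times> \<beta>)"
        unfolding eq by (intro blinfun_eqI) simp
    qed (use S setsAB in simp)
    moreover have "symmetric_op (G' z S)"
      using S setsAB by (intro effect_symmetric effect_measureD(1)[OF eff']) simp
    ultimately show "G' z S \<in> projections" by (simp add: projections_iff)
  qed
  with channel unique show ?thesis by blast
qed

end
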